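(* Let $d\ge1$ and let $\Psi\in\mathcal B_0$ (not identically zero) satisfy, for some $\mu>0$ and $\underline c\in(0,1]$, $\Psi(\gamma u)\ge\underline c\,\gamma^\mu\Psi(u)$ for all $u>0$, $\gamma\ge1$. Then there exist constants $\varrho_1,\varrho_2>0$, depending only on $\Psi$, such that the following holds. Let $\mathcal K\subset\mathbb R^d$ be a bounded convex set with non-empty interior, $v>0$, $V=-v\mathbf 1_{\mathcal K}$, let $\varphi\not\equiv0$ be a solution in $L^2(\mathbb R^d)$ of $(\Psi(-\Delta)+V)\varphi=\lambda\varphi$ with eigenvalue $\lambda=-|\lambda|<0$, and let $x^*$ be a location of a global maximum of $|\varphi|$. If $$\frac{v-|\lambda|}{|\lambda|}\ \le\ \varrho_1 ,$$ then $x^*\in\operatorname{Int}\mathcal K$ and $$\operatorname{dist}(x^*,\partial\mathcal K)\ \ge\ \frac{1}{\sqrt{\Psi^{-1}\big(|\lambda|/\varrho_2\big)}} .$$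
   Context: $\mathcal B_0$ is the set of Bernstein functions vanishing at zero: $f\in C^\infty((0,\infty))$, $f\ge0$, $(-1)^n f^{(n)}\le 0$ for all $n\ge1$, and $\lim_{u\downarrow0}f(u)=0$. $\Psi(-\Delta)$ is the operator with Fourier multiplier $\Psi(|y|^2)$. Let $(S^\Psi_t)_{t\ge0}$ be the subordinator with $\mathbb E[e^{-uS^\Psi_t}]=e^{-t\Psi(u)}$, $(B_t)_{t\ge0}$ an independent $d$-dimensional Brownian motion running twice as fast as standard Brownian motion, and $X_t=B_{S^\Psi_t}$; $\mathbb E^x$ is expectation for $X$ started at $x$. Eigenfunctions are bounded continuous functions $\varphi\in L^2(\mathbb R^d)$ satisfying the Feynman-Kac representation $\varphi(x)=e^{\lambda t}\,\mathbb E^x\big[e^{-\int_0^tV(X_s)ds}\varphi(X_t)\big]$ for all $x\in\mathbb R^d$, $t\ge0$. $\operatorname{Int}\mathcal K$ is the interior of $\mathcal K$. *)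

theory Defs
  imports "HOL-Probability.Probability"
begin

text \<open>
  The dimension \<open>d\<close> is a natural number rather than a type, so that constants can be quantified
  before it. The space of \<open>d\<close>-dimensional vectors is \<open>{..<d} \<rightarrow>\<^sub>E UNIV\<close>, the common carrier of the
  library's product topology and of its product measures. All vectors are extensional functions;
  vector expressions are therefore written with \<open>restrict\<close>.
\<close>

definition vspace :: "nat \<Rightarrow> (nat \<Rightarrow> real) set" where
  "vspace d = (\<Pi>\<^sub>E i\<in>{..<d}. UNIV)"

definition vtop :: "nat \<Rightarrow> (nat \<Rightarrow> real) topology" where
  "vtop d = product_topology (\<lambda>_. euclideanreal) {..<d}"

definition vborel :: "nat \<Rightarrow> (nat \<Rightarrow> real) measure" where
  "vborel d = (\<Pi>\<^sub>M i\<in>{..<d}. borel)"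

definition vlborel :: "nat \<Rightarrow> (nat \<Rightarrow> real) measure" where
  "vlborel d = (\<Pi>\<^sub>M i\<in>{..<d}. lborel)"

definition vnorm :: "nat \<Rightarrow> (nat \<Rightarrow> real) \<Rightarrow> real" where
  "vnorm d x = L2_set x {..<d}"

definition vdist :: "nat \<Rightarrow> (nat \<Rightarrow> real) \<Rightarrow> (nat \<Rightarrow> real) \<Rightarrow> real" where
  "vdist d x y = L2_set (\<lambda>i. x i - y i) {..<d}"

definition vsetdist :: "nat \<Rightarrow> (nat \<Rightarrow> real) \<Rightarrow> (nat \<Rightarrow> real) set \<Rightarrow> real" where
  "vsetdist d x A = (INF z\<in>A. vdist d x z)"

definition vbounded :: "nat \<Rightarrow> (nat \<Rightarrow> real) set \<Rightarrow> bool" where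
  "vbounded d K \<longleftrightarrow> (\<exists>R. \<forall>x\<in>K. vnorm d x \<le> R)"

definition vconvex :: "nat \<Rightarrow> (nat \<Rightarrow> real) set \<Rightarrow> bool" where
  "vconvex d K \<longleftrightarrow>
     (\<forall>x\<in>K. \<forall>y\<in>K. \<forall>a\<in>{0..1}. (\<lambda>i\<in>{..<d}. (1 - a) * x i + a * y i) \<in> K)"


text \<open>The class \<open>B\<^sub>0\<close>; only the values on the open half-line matter.\<close>

definition bernstein0 :: "(real \<Rightarrow> real) \<Rightarrow> bool" where
  "bernstein0 f \<longleftrightarrow>
     (\<forall>n. \<forall>u>0. (deriv ^^ n) f field_differentiable at u) \<and>
     (\<forall>u>0. 0 \<le> f u) \<and>
     (\<forall>n\<ge>1. \<forall>u>0. (-1) ^ n * (deriv ^^ n) f u \<le> 0) \<and>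
     (f \<longlongrightarrow> 0) (at_right 0)"

definition lower_scaling :: "(real \<Rightarrow> real) \<Rightarrow> real \<Rightarrow> real \<Rightarrow> bool" where
  "lower_scaling Psi mu c \<longleftrightarrow>
     (\<forall>u>0. \<forall>\<gamma>\<ge>1. Psi (\<gamma> * u) \<ge> c * \<gamma> powr mu * Psi u)"


definition subordinator ::
    "'w measure \<Rightarrow> (real \<Rightarrow> real) \<Rightarrow> (real \<Rightarrow> 'w \<Rightarrow> real) \<Rightarrow> bool" where
  "subordinator M Psi S \<longleftrightarrow>
     (\<forall>t\<ge>0. S t \<in> borel_measurable M) \<and>
     (AE \<omega> in M. S 0 \<omega> = 0 \<and> mono_on {0..} (\<lambda>t. S t \<omega>) \<and>
                 (\<forall>t\<ge>0. continuous (at_right t) (\<lambda>s. S s \<omega>))) \<and>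
     (\<forall>(n::nat) \<tau>. 0 \<le> \<tau> 0 \<and> mono \<tau> \<longrightarrow>
        prob_space.indep_vars M (\<lambda>_. borel) (\<lambda>k \<omega>. S (\<tau> (Suc k)) \<omega> - S (\<tau> k) \<omega>) {..<n}) \<and>
     (\<forall>s\<ge>0. \<forall>t\<ge>0. distr M borel (\<lambda>\<omega>. S (s + t) \<omega> - S s \<omega>) = distr M borel (S t)) \<and>
     (\<forall>t\<ge>0. \<forall>u>0. (LINT \<omega>|M. exp (- u * S t \<omega>)) = exp (- t * Psi u))"

text \<open>
  Brownian motion started at the origin and running at twice the standard speed: the coordinates
  of an increment over \<open>[s, t]\<close> are independent with variance \<open>2 (t - s)\<close>. Note that
  \<^const>\<open>normal_density\<close> takes the standard deviation.
\<close>

definition fast_brownian ::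
    "'w measure \<Rightarrow> nat \<Rightarrow> (real \<Rightarrow> 'w \<Rightarrow> nat \<Rightarrow> real) \<Rightarrow> bool" where
  "fast_brownian M d B \<longleftrightarrow>
     (\<forall>t\<ge>0. B t \<in> M \<rightarrow>\<^sub>M vborel d) \<and>
     (AE \<omega> in M. \<forall>i<d. B 0 \<omega> i = 0 \<and> continuous_on {0..} (\<lambda>t. B t \<omega> i)) \<and>
     (\<forall>(n::nat) \<tau>. 0 \<le> \<tau> 0 \<and> mono \<tau> \<longrightarrow>
        prob_space.indep_vars M (\<lambda>_. vborel d)
          (\<lambda>k \<omega>. \<lambda>i\<in>{..<d}. B (\<tau> (Suc k)) \<omega> i - B (\<tau> k) \<omega> i) {..<n}) \<and>
     (\<forall>s t. 0 \<le> s \<and> s < t \<longrightarrow>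
        distr M (vborel d) (\<lambda>\<omega>. \<lambda>i\<in>{..<d}. B t \<omega> i - B s \<omega> i) =
        (\<Pi>\<^sub>M i\<in>{..<d}. density lborel (\<lambda>x. ennreal (normal_density 0 (sqrt (2 * (t - s))) x))))"

definition independent_processes ::
    "'w measure \<Rightarrow> nat \<Rightarrow> (real \<Rightarrow> 'w \<Rightarrow> real) \<Rightarrow> (real \<Rightarrow> 'w \<Rightarrow> nat \<Rightarrow> real) \<Rightarrow> bool" where
  "independent_processes M d S B \<longleftrightarrow>
     prob_space.indep_set M
       (sets (vimage_algebra (space M) (\<lambda>\<omega>. \<lambda>t\<in>{0..}. S t \<omega>) (\<Pi>\<^sub>M t\<in>{0..}. borel)))
       (sets (vimage_algebra (space M) (\<lambda>\<omega>. \<lambda>t\<in>{0..}. B t \<omega>) (\<Pi>\<^sub>M t\<in>{0..}. vborel d)))"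

definition subordinate_setting ::
    "'w measure \<Rightarrow> (real \<Rightarrow> real) \<Rightarrow> nat \<Rightarrow> (real \<Rightarrow> 'w \<Rightarrow> real)
      \<Rightarrow> (real \<Rightarrow> 'w \<Rightarrow> nat \<Rightarrow> real) \<Rightarrow> bool" where
  "subordinate_setting M Psi d S B \<longleftrightarrow>
     prob_space M \<and> subordinator M Psi S \<and> fast_brownian M d B \<and> independent_processes M d S B"

text \<open>The subordinate Brownian motion started at \<open>x\<close>.\<close>

definition subordinate_bm ::
    "nat \<Rightarrow> (real \<Rightarrow> 'w \<Rightarrow> real) \<Rightarrow> (real \<Rightarrow> 'w \<Rightarrow> nat \<Rightarrow> real)
      \<Rightarrow> (nat \<Rightarrow> real) \<Rightarrow> real \<Rightarrow> 'w \<Rightarrow> nat \<Rightarrow> real" where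
  "subordinate_bm d S B x t \<omega> = (\<lambda>i\<in>{..<d}. x i + B (S t \<omega>) \<omega> i)"


definition L2_fun :: "nat \<Rightarrow> ((nat \<Rightarrow> real) \<Rightarrow> complex) \<Rightarrow> bool" where
  "L2_fun d f \<longleftrightarrow>
     f \<in> borel_measurable (vlborel d) \<and> integrable (vlborel d) (\<lambda>x. (cmod (f x))\<^sup>2)"

text \<open>
  \<open>F\<close> is (a version of) the Plancherel transform of \<open>f\<close>: the \<open>L\<^sup>2\<close>-limit of the Fourier integrals
  of the truncations of \<open>f\<close>. The normalising constant is omitted, as it cancels in
  \<open>fourier_multiplier\<close>.
\<close>

definition L2_fourier ::
    "nat \<Rightarrow> ((nat \<Rightarrow> real) \<Rightarrow> complex) \<Rightarrow> ((nat \<Rightarrow> real) \<Rightarrow> complex) \<Rightarrow> bool" where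
  "L2_fourier d f F \<longleftrightarrow> L2_fun d f \<and> L2_fun d F \<and>
     ((\<lambda>n::nat. \<integral>\<^sup>+ y. ennreal ((cmod (F y -
          (LINT x:{x \<in> vspace d. vnorm d x \<le> real n}|vlborel d.
             cis (- (\<Sum>i<d. x i * y i)) * f x)))\<^sup>2) \<partial>vlborel d) \<longlonglongrightarrow> 0)"

text \<open>
  \<open>f\<close> lies in the \<open>L\<^sup>2\<close>-domain of the operator with Fourier multiplier \<open>m\<close>, which maps it to \<open>g\<close>.
\<close>

definition fourier_multiplier ::
    "nat \<Rightarrow> ((nat \<Rightarrow> real) \<Rightarrow> real) \<Rightarrow> ((nat \<Rightarrow> real) \<Rightarrow> complex)
      \<Rightarrow> ((nat \<Rightarrow> real) \<Rightarrow> complex) \<Rightarrow> bool" where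
  "fourier_multiplier d m f g \<longleftrightarrow>
     (\<exists>F G. L2_fourier d f F \<and> L2_fourier d g G \<and>
        (AE y in vlborel d. G y = complex_of_real (m y) * F y))"

definition schroedinger_equation ::
    "nat \<Rightarrow> (real \<Rightarrow> real) \<Rightarrow> ((nat \<Rightarrow> real) \<Rightarrow> real) \<Rightarrow> real
      \<Rightarrow> ((nat \<Rightarrow> real) \<Rightarrow> complex) \<Rightarrow> bool" where
  "schroedinger_equation d Psi V eig \<phi> \<longleftrightarrow>
     (\<exists>g. fourier_multiplier d (\<lambda>y. Psi ((vnorm d y)\<^sup>2)) \<phi> g \<and>
        (AE x in vlborel d.
           g x + complex_of_real (V x) * \<phi> x = complex_of_real eig * \<phi> x))"

text \<open>
  The potential need only be Lebesgue measurable (an arbitrary convex set need not be Borel), so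
  time integrals are taken with respect to \<^const>\<open>lebesgue\<close> and expectations with respect to the
  completed probability measure.
\<close>

definition feynman_kac ::
    "'w measure \<Rightarrow> nat \<Rightarrow> (real \<Rightarrow> 'w \<Rightarrow> real) \<Rightarrow> (real \<Rightarrow> 'w \<Rightarrow> nat \<Rightarrow> real)
      \<Rightarrow> ((nat \<Rightarrow> real) \<Rightarrow> real) \<Rightarrow> real \<Rightarrow> ((nat \<Rightarrow> real) \<Rightarrow> complex) \<Rightarrow> bool" where
  "feynman_kac M d S B V eig \<phi> \<longleftrightarrow>
     (\<forall>x\<in>vspace d. \<forall>t\<ge>0.
        \<phi> x = complex_of_real (exp (eig * t)) *
          (LINT \<omega>|completion M.
             complex_of_real
               (exp (- (LINT s:{0..t}|lebesgue. V (subordinate_bm d S B x s \<omega>)))) *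
             \<phi> (subordinate_bm d S B x t \<omega>)))"

definition eigenfunction ::
    "'w measure \<Rightarrow> (real \<Rightarrow> real) \<Rightarrow> nat \<Rightarrow> (real \<Rightarrow> 'w \<Rightarrow> real)
      \<Rightarrow> (real \<Rightarrow> 'w \<Rightarrow> nat \<Rightarrow> real) \<Rightarrow> ((nat \<Rightarrow> real) \<Rightarrow> real) \<Rightarrow> real
      \<Rightarrow> ((nat \<Rightarrow> real) \<Rightarrow> complex) \<Rightarrow> bool" where
  "eigenfunction M Psi d S B V eig \<phi> \<longleftrightarrow>
     (\<exists>x\<in>vspace d. \<phi> x \<noteq> 0) \<and>
     bounded (\<phi> ` vspace d) \<and> continuous_map (vtop d) euclidean \<phi> \<and> L2_fun d \<phi> \<and>
     schroedinger_equation d Psi V eig \<phi> \<and> feynman_kac M d S B V eig \<phi>"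

definition well_potential :: "real \<Rightarrow> (nat \<Rightarrow> real) set \<Rightarrow> (nat \<Rightarrow> real) \<Rightarrow> real" where
  "well_potential v K x = - v * indicator K x"

end

(*
  At a maximum x* of |phi| the Feynman-Kac formula at time T = 1/|lambda| gives
  e <= E[exp (v U)], where U is the time spent in K up to T. If x* were too close to the complement
  of K, some half-space at distance at most R = 1 / sqrt (Psi^{-1} (4 |lambda|)) from x* would miss
  K. At each time s in [T/2, T] the process lies in that half-space with probability bounded below:
  the Laplace transform gives S_s >= R^2 with probability at least 1/2, and a centred Gaussian of
  variance 2 S_s then exceeds 2 R with probability at least the normal tail beyond 2. So U falls
  short of T by a fixed proportion on average, contradicting the inequality when v is close
  to |lambda|.
*)
theory Submission
  imports Defs
begin

subsection \<open>Convex sets\<close>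

text \<open>Two obstacles shape the proof. \<open>K\<close> is merely convex, possibly neither
  closed nor Borel: the time spent in it may fail to be measurable, and a nearest point of it may
  not exist. Hence \<open>K\<close> is replaced by a half-space containing it, found from an
  approximate nearest point; the time spent beyond that half-space is measurable. Secondly,
  independence and the Gaussian law speak of fixed times, while the Brownian motion is evaluated at
  the random time \<open>S t\<close>; rounding \<open>S t\<close> up to a grid splits events into
  countably many pieces on which the time is constant. Jensen's inequality would bound the mean of
  the exponential from below. The upper bound comes from exp(-x) <= 1 - x/2 on [0,1], which makes
  the mean occupation time sufficient. Only the projection onto the normal of the half-space enters,
  a Brownian motion on the line whatever \<open>d\<close> is. So the constants
  \<open>gauss_tail / 8\<close> and \<open>1 / 4\<close> depend neither on \<open>d\<close> nor on
  \<open>K\<close>, and not even on \<open>Psi\<close>.\<close>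

lemma sum_sq_add_scaled:
  fixes a b :: "nat \<Rightarrow> real"
  shows "(\<Sum>i\<in>I. (a i - h * b i)\<^sup>2) =
    (\<Sum>i\<in>I. (a i)\<^sup>2) - 2 * h * (\<Sum>i\<in>I. a i * b i) + h\<^sup>2 * (\<Sum>i\<in>I. (b i)\<^sup>2)"
  by (simp add: power2_diff sum.distrib sum_subtractf sum_distrib_left power_mult_distrib mult_ac)

lemma vdist_triangle: "vdist d x z \<le> vdist d x y + vdist d y z"
  using L2_set_triangle_ineq[of "\<lambda>i. x i - y i" "\<lambda>i. y i - z i" "{..<d}"] by (simp add: vdist_def)

text \<open>Variational inequality at an approximate nearest point \<open>p\<close>, with normal
  \<open>z - p\<close>. The half-space only has to pass through \<open>z\<close>, not through
  \<open>p\<close>; this leaves a slack of the squared distance \<open>m\<close>, which absorbs the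
  error made because the infimum need not be attained.\<close>

lemma separation_of_distant_point:
  assumes conv: "vconvex d K" and bdd: "vbounded d K" and "K \<noteq> {}"
    and "D > 0" and far: "\<And>y. y \<in> K \<Longrightarrow> D \<le> vdist d z y"
  shows "\<exists>e. (\<Sum>i<d. (e i)\<^sup>2) = 1 \<and> (\<forall>y\<in>K. (\<Sum>i<d. e i * (y i - z i)) \<le> 0)"
proof -
  define Q where "Q y = (\<Sum>i<d. (z i - y i)\<^sup>2)" for y
  define m where "m = (INF y\<in>K. Q y)"
  have Q_far: "D\<^sup>2 \<le> Q y" if "y \<in> K" for y
  proof -
    have "D\<^sup>2 \<le> (vdist d z y)\<^sup>2" using far[OF that] \<open>D > 0\<close> by (intro power_mono) auto
    also have "\<dots> = Q y" by (simp add: vdist_def Q_def L2_set_def sum_nonneg)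
    finally show ?thesis .
  qed
  have bb: "bdd_below (Q ` K)" using Q_far by (intro bdd_belowI2[of _ "D\<^sup>2"])
  have m_le: "m \<le> Q y" if "y \<in> K" for y unfolding m_def using bb that by (rule cINF_lower)
  have "D\<^sup>2 \<le> m" unfolding m_def by (rule cINF_greatest) (use Q_far \<open>K \<noteq> {}\<close> in auto)
  hence mpos: "m > 0" using \<open>D > 0\<close> by (smt (verit) zero_less_power)
  obtain R where R: "\<And>x. x \<in> K \<Longrightarrow> vnorm d x \<le> R" using bdd by (auto simp: vbounded_def)
  have sqR: "(\<Sum>i<d. (x i)\<^sup>2) \<le> R\<^sup>2" if "x \<in> K" for x
  proof -
    have "0 \<le> vnorm d x" by (simp add: vnorm_def L2_set_nonneg)
    hence "(vnorm d x)\<^sup>2 \<le> R\<^sup>2" using R[OF that] by (intro power_mono) auto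
    thus ?thesis by (simp add: vnorm_def L2_set_def sum_nonneg)
  qed
  define W where "W = 4 * R\<^sup>2 + 1"
  have W: "(\<Sum>i<d. (y i - p i)\<^sup>2) \<le> W" if "y \<in> K" "p \<in> K" for y p
  proof -
    have "(\<Sum>i<d. (y i - p i)\<^sup>2) \<le> (\<Sum>i<d. 2 * (y i)\<^sup>2 + 2 * (p i)\<^sup>2)"
      by (rule sum_mono)
        (use zero_le_power2 in \<open>smt (verit, best) power2_diff power2_sum\<close>)
    also have "\<dots> = 2 * (\<Sum>i<d. (y i)\<^sup>2) + 2 * (\<Sum>i<d. (p i)\<^sup>2)"
      by (simp add: sum.distrib sum_distrib_left)
    also have "\<dots> \<le> W" using sqR[OF that(1)] sqR[OF that(2)] by (simp add: W_def)
    finally show ?thesis .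
  qed
  have Wpos: "W > 0" unfolding W_def using zero_le_power2[of R] by linarith
  \<comment> \<open>\<open>W\<close> bounds the squared diameter of \<open>K\<close>. With
    \<open>h * W \<le> m\<close>, the excess of \<open>Q p\<close> over the infimum and the
    second-order term of a step of length \<open>h\<close> are each at most
    \<open>h * m\<close>.\<close>
  define h where "h = m / (W + m)"
  have h: "0 < h" "h < 1" "h * W \<le> m"
    using mpos Wpos by (auto simp: h_def field_simps)
  have "m < m + h * m" using mpos h by simp
  then obtain p where p: "p \<in> K" "Q p < m + h * m"
    using cInf_lessD[of "Q ` K" "m + h * m"] \<open>K \<noteq> {}\<close> by (auto simp: m_def)
  have key: "(\<Sum>i<d. (z i - p i) * (y i - p i)) \<le> m" (is "?s \<le> m") if "y \<in> K" for y
  proof -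
    let ?w = "\<lambda>i\<in>{..<d}. (1 - h) * p i + h * y i"
    have "?w \<in> K" using conv p(1) that h unfolding vconvex_def by auto
    hence "m \<le> Q ?w" by (rule m_le)
    also have "Q ?w = (\<Sum>i<d. ((z i - p i) - h * (y i - p i))\<^sup>2)"
      unfolding Q_def by (rule sum.cong) (auto simp: algebra_simps)
    also have "\<dots> = Q p - 2 * h * ?s + h\<^sup>2 * (\<Sum>i<d. (y i - p i)\<^sup>2)"
      unfolding sum_sq_add_scaled Q_def ..
    also have "\<dots> \<le> m + h * m - 2 * h * ?s + h\<^sup>2 * W"
      using p(2) W[OF that p(1)] by (smt (verit) mult_left_mono zero_le_power2)
    also have "h\<^sup>2 * W \<le> h * m"
      using h by (simp add: power2_eq_square mult.assoc)
    finally have "h * ?s \<le> h * m" by simp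
    thus ?thesis using h by simp
  qed
  define N where "N = sqrt (Q p)"
  have Npos: "N > 0" using m_le[OF p(1)] mpos by (simp add: N_def)
  have N2: "N\<^sup>2 = Q p" using Npos by (simp add: N_def)
  show ?thesis
  proof (intro exI[of _ "\<lambda>i. (z i - p i) / N"] conjI ballI)
    have "(\<Sum>i<d. ((z i - p i) / N)\<^sup>2) = Q p / N\<^sup>2"
      unfolding Q_def sum_divide_distrib by (rule sum.cong) (auto simp: power_divide)
    also have "\<dots> = 1" unfolding N2 using m_le[OF p(1)] mpos by simp
    finally show "(\<Sum>i<d. ((z i - p i) / N)\<^sup>2) = 1" .
  next
    fix y assume "y \<in> K"
    have "(\<Sum>i<d. (z i - p i) * (y i - p i)) - Q p =
        (\<Sum>i<d. (z i - p i) * (y i - p i) - (z i - p i)\<^sup>2)"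
      unfolding Q_def by (rule sum_subtractf[symmetric])
    also have "\<dots> = (\<Sum>i<d. (z i - p i) * (y i - z i))"
      by (rule sum.cong) (auto simp: algebra_simps power2_eq_square)
    finally have "(\<Sum>i<d. (z i - p i) * (y i - z i)) \<le> 0"
      using key[OF \<open>y \<in> K\<close>] m_le[OF p(1)] by linarith
    hence "(\<Sum>i<d. (z i - p i) * (y i - z i)) / N \<le> 0"
      using Npos by (rule divide_nonpos_pos)
    thus "(\<Sum>i<d. (z i - p i) / N * (y i - z i)) \<le> 0"
      unfolding sum_divide_distrib by simp
  qed
qed

text \<open>
  Pushing \<open>z\<close> away from an interior point \<open>c\<close> yields a point at positive distance from \<open>K\<close>, so
  that no compactness is needed for the separation.
\<close>

lemma separating_direction:
  assumes conv: "vconvex d K" and bdd: "vbounded d K"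
    and c: "c \<in> vspace d" and "\<epsilon> > 0" and ball: "\<And>y. y \<in> vspace d \<Longrightarrow> vdist d c y < \<epsilon> \<Longrightarrow> y \<in> K"
    and z: "z \<in> vspace d" "z \<notin> K" and close: "vdist d x z < R"
  shows "\<exists>e. (\<Sum>i<d. (e i)\<^sup>2) = 1 \<and> (\<forall>y\<in>K. (\<Sum>i<d. e i * (y i - x i)) \<le> R)"
proof -
  have nn: "vdist d a b \<ge> 0" for a b by (simp add: vdist_def L2_set_nonneg)
  have cK: "c \<in> K" using ball[OF c] \<open>\<epsilon> > 0\<close> by (simp add: vdist_def L2_set_def)
  \<comment> \<open>The largest convenient push: \<open>w\<close> moves away from \<open>z\<close>
    by at most the room left in the ball of radius \<open>R\<close> around \<open>x\<close>. The
    summand 1 keeps the denominator positive.\<close>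
  define h where "h = (R - vdist d x z) / (vdist d z c + 1)"
  have h: "h > 0" using close nn[of z c] by (simp add: h_def)
  define w where "w = (\<lambda>i. z i + h * (z i - c i))"
  have zw: "vdist d z w = h * vdist d z c"
  proof -
    have "vdist d z w = L2_set (\<lambda>i. \<bar>h\<bar> * \<bar>z i - c i\<bar>) {..<d}"
      unfolding vdist_def L2_set_def w_def by (simp add: power_mult_distrib)
    also have "\<dots> = h * L2_set (\<lambda>i. \<bar>z i - c i\<bar>) {..<d}"
      using h by (simp add: L2_set_right_distrib)
    also have "\<dots> = h * vdist d z c" unfolding vdist_def L2_set_def by simp
    finally show ?thesis .
  qed
  have "vdist d x w \<le> vdist d x z + h * vdist d z c"
    using vdist_triangle[of d x w z] zw by simp
  also have "h * vdist d z c \<le> h * (vdist d z c + 1)" using h by simp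
  also have "\<dots> = R - vdist d x z" unfolding h_def using nn[of z c] by (simp add: add_nonneg_eq_0_iff)
  finally have xw: "vdist d x w \<le> R" by simp
  have far: "h * \<epsilon> \<le> vdist d w y" if y: "y \<in> K" for y
  proof (rule ccontr)
    assume "\<not> h * \<epsilon> \<le> vdist d w y"
    hence lt: "vdist d w y < h * \<epsilon>" by simp
    \<comment> \<open>Since z = (w + h c) / (1 + h), also z = (y + h g) / (1 + h). If
      \<open>y\<close> in \<open>K\<close> were too close to \<open>w\<close>, then \<open>g\<close>
      would lie in the ball around \<open>c\<close>, and convexity would put \<open>z\<close> into
      \<open>K\<close>.\<close>
    define g where "g = (\<lambda>i\<in>{..<d}. c i + (w i - y i) / h)"
    have "vdist d c g = L2_set (\<lambda>i. (1/h) * \<bar>w i - y i\<bar>) {..<d}"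
      unfolding vdist_def L2_set_def g_def by (simp add: power_mult_distrib power_divide)
    also have "\<dots> = (1/h) * L2_set (\<lambda>i. \<bar>w i - y i\<bar>) {..<d}"
      using h by (subst L2_set_right_distrib) auto
    also have "\<dots> = vdist d w y / h" unfolding vdist_def L2_set_def by simp
    also have "\<dots> < \<epsilon>" using lt h by (simp add: field_simps)
    finally have "g \<in> K" by (intro ball) (auto simp: g_def vspace_def)
    define a where "a = h / (1 + h)"
    have a: "a \<in> {0..1}" using h by (auto simp: a_def)
    have "(\<lambda>i\<in>{..<d}. (1 - a) * y i + a * g i) = z"
    proof
      fix i
      show "(\<lambda>i\<in>{..<d}. (1 - a) * y i + a * g i) i = z i"
      proof (cases "i < d")
        case True
        define k where "k = 1 / (1 + h)"
        have k1: "k * (1 + h) = 1" and ak: "a = h * k" using h by (auto simp: k_def a_def)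
        have k: "k * h = a" "a / h = k" using h ak by simp_all
        have k2: "1 - a = k" using k1 k(1) by (simp add: distrib_left)
        have "a * g i = a * c i + (a / h) * (w i - y i)"
          using True by (simp add: g_def distrib_left)
        hence "(1 - a) * y i + a * g i = k * y i + (k * h) * c i + k * (w i - y i)"
          unfolding k k2 by simp
        also have "\<dots> = (k * (1 + h)) * z i" by (simp add: w_def algebra_simps)
        finally show ?thesis using True unfolding k1 by simp
      next
        case False
        have "z i = undefined" by (rule PiE_arb[OF z(1)[unfolded vspace_def]]) (use False in simp)
        thus ?thesis using False by simp
      qed
    qed
    moreover have "(\<lambda>i\<in>{..<d}. (1 - a) * y i + a * g i) \<in> K"
      using conv[unfolded vconvex_def, THEN bspec, OF y, THEN bspec, OF \<open>g \<in> K\<close>, THEN bspec, OF a] .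
    ultimately show False using z(2) by metis
  qed
  have "\<exists>e. (\<Sum>i<d. (e i)\<^sup>2) = 1 \<and> (\<forall>y\<in>K. (\<Sum>i<d. e i * (y i - w i)) \<le> 0)"
    by (rule separation_of_distant_point[OF conv bdd _ _ far]) (use cK h \<open>\<epsilon> > 0\<close> in auto)
  then obtain e where e: "(\<Sum>i<d. (e i)\<^sup>2) = 1" "\<And>y. y \<in> K \<Longrightarrow> (\<Sum>i<d. e i * (y i - w i)) \<le> 0"
    by blast
  have "(\<Sum>i<d. e i * (y i - x i)) \<le> R" if "y \<in> K" for y
  proof -
    \<comment> \<open>The half-space through \<open>w\<close> is re-centred at \<open>x\<close>; by
      Cauchy-Schwarz this costs at most the distance from \<open>x\<close> to \<open>w\<close>,
      which is at most \<open>R\<close>.\<close>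
    have "(\<Sum>i<d. e i * (y i - x i)) = (\<Sum>i<d. e i * (y i - w i)) + (\<Sum>i<d. e i * (w i - x i))"
      unfolding sum.distrib[symmetric] by (rule sum.cong) (auto simp: algebra_simps)
    also have "\<dots> \<le> (\<Sum>i<d. e i * (w i - x i))" using e(2)[OF that] by simp
    also have "\<dots> \<le> (\<Sum>i<d. \<bar>e i\<bar> * \<bar>w i - x i\<bar>)"
      by (rule sum_mono) (metis abs_mult abs_ge_self)
    also have "\<dots> \<le> L2_set e {..<d} * L2_set (\<lambda>i. w i - x i) {..<d}" by (rule L2_set_mult_ineq)
    also have "\<dots> = vdist d x w"
      using e(1) by (simp add: L2_set_def vdist_def power2_commute)
    finally show ?thesis using xw by simp
  qed
  thus ?thesis using e(1) by blast
qed

section \<open>Interior and frontier in the product topology\<close>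

text \<open>Boxes and Euclidean balls are nested in each other: every coordinate difference is at
  most \<open>vdist\<close>, and \<open>vdist\<close> is at most the sum of the coordinate
  differences.\<close>

lemma vtop_interior_iff:
  assumes "x \<in> vspace d"
  shows "x \<in> vtop d interior_of K \<longleftrightarrow> (\<exists>\<epsilon>>0. \<forall>y\<in>vspace d. vdist d x y < \<epsilon> \<longrightarrow> y \<in> K)"
proof
  assume "x \<in> vtop d interior_of K"
  then obtain T where T: "openin (vtop d) T" "x \<in> T" "T \<subseteq> K" by (auto simp: interior_of_def)
  obtain U where "\<forall>i\<in>{..<d}. openin euclideanreal (U i)"
    and U2: "x \<in> Pi\<^sub>E {..<d} U" "Pi\<^sub>E {..<d} U \<subseteq> T"
    using T(1)[unfolded vtop_def openin_product_topology_alt, THEN bspec, OF T(2)] by (elim exE conjE)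
  hence U1: "open (U i)" if "i < d" for i using that by simp
  have "\<exists>r>0. ball (x i) r \<subseteq> U i" if "i < d" for i
  proof -
    have "x i \<in> U i" using PiE_mem[OF U2(1)] that by simp
    thus ?thesis using open_contains_ball_eq[OF U1[OF that]] by simp
  qed
  hence "\<exists>r. \<forall>i\<in>{..<d}. r i > 0 \<and> ball (x i) (r i) \<subseteq> U i" by (intro bchoice) simp
  then obtain r where r: "\<And>i. i < d \<Longrightarrow> r i > 0 \<and> ball (x i) (r i) \<subseteq> U i" by auto
  \<comment> \<open>The inserted 1 keeps the set under \<open>Min\<close> non-empty when
    \<open>d\<close> is 0.\<close>
  define \<epsilon> where "\<epsilon> = Min (insert 1 (r ` {..<d}))"
  have \<epsilon>: "\<epsilon> > 0" unfolding \<epsilon>_def using r by (subst Min_gr_iff) auto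
  have "y \<in> K" if y: "y \<in> vspace d" "vdist d x y < \<epsilon>" for y
  proof -
    have "y i \<in> U i" if i: "i < d" for i
    proof -
      have "\<bar>x i - y i\<bar> \<le> L2_set (\<lambda>i. \<bar>x i - y i\<bar>) {..<d}"
        using i by (intro member_le_L2_set) auto
      also have "\<dots> = vdist d x y" by (simp add: vdist_def L2_set_def)
      also have "\<dots> < \<epsilon>" by (rule y(2))
      also have "\<epsilon> \<le> r i" unfolding \<epsilon>_def using i by (intro Min_le) auto
      finally have "y i \<in> ball (x i) (r i)" by (simp add: dist_real_def)
      thus ?thesis using r[OF i] by blast
    qed
    moreover have "y \<in> extensional {..<d}" using y(1) by (simp add: vspace_def PiE_iff)
    ultimately have "y \<in> Pi\<^sub>E {..<d} U" by (simp add: PiE_iff)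
    thus ?thesis using U2(2) T(3) by blast
  qed
  thus "\<exists>\<epsilon>>0. \<forall>y\<in>vspace d. vdist d x y < \<epsilon> \<longrightarrow> y \<in> K" using \<epsilon> by blast
next
  assume "\<exists>\<epsilon>>0. \<forall>y\<in>vspace d. vdist d x y < \<epsilon> \<longrightarrow> y \<in> K"
  then obtain \<epsilon> where \<epsilon>: "\<epsilon> > 0" "\<And>y. y \<in> vspace d \<Longrightarrow> vdist d x y < \<epsilon> \<Longrightarrow> y \<in> K" by blast
  define r where "r = \<epsilon> / (real d + 1)"
  have r: "r > 0" using \<epsilon> by (simp add: r_def)
  define T where "T = (\<Pi>\<^sub>E i\<in>{..<d}. ball (x i) r)"
  have "openin (vtop d) T"
    unfolding vtop_def T_def by (subst openin_PiE) auto
  moreover have "x \<in> T" using assms r by (auto simp: T_def vspace_def PiE_iff)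
  moreover have "T \<subseteq> K"
  proof
    fix y assume y: "y \<in> T"
    have "vdist d x y \<le> (\<Sum>i<d. \<bar>x i - y i\<bar>)"
      unfolding vdist_def by (rule L2_set_le_sum_abs)
    also have "\<dots> \<le> (\<Sum>i<d. r)"
    proof (rule sum_mono)
      fix i assume "i \<in> {..<d}"
      hence "y i \<in> ball (x i) r" using y unfolding T_def by (rule PiE_mem[rotated])
      thus "\<bar>x i - y i\<bar> \<le> r" by (simp add: dist_real_def)
    qed
    also have "\<dots> < \<epsilon>" using \<epsilon>(1) by (simp add: r_def field_simps)
    finally show "y \<in> K" using y by (intro \<epsilon>(2)) (auto simp: T_def vspace_def PiE_iff)
  qed
  ultimately show "x \<in> vtop d interior_of K" by (auto simp: interior_of_def)
qed

text \<open>Needed because the infimum in \<open>vsetdist\<close> over an empty set would be an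
  unspecified real. In a connected space a non-empty set with empty frontier is everything, hence
  unbounded in positive dimension.\<close>

lemma vtop_frontier_nonempty:
  assumes "d \<ge> 1" "K \<subseteq> vspace d" "K \<noteq> {}" and bdd: "vbounded d K"
  shows "vtop d frontier_of K \<noteq> {}"
proof
  assume "vtop d frontier_of K = {}"
  moreover have "connectedin euclideanreal UNIV" by (simp add: connectedin_iff_connected)
  hence "connected_space euclideanreal" by (simp add: connectedin_def)
  hence "connected_space (vtop d)"
    unfolding vtop_def connected_space_product_topology by blast
  moreover have "topspace (vtop d) = vspace d" by (simp add: vtop_def vspace_def)
  ultimately have K: "K = vspace d"
    using assms(2,3) unfolding connected_space_eq_frontier_eq_empty by blast
  obtain R where R: "\<And>x. x \<in> K \<Longrightarrow> vnorm d x \<le> R" using bdd by (auto simp: vbounded_def)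
  define x where "x = (\<lambda>i\<in>{..<d}. \<bar>R\<bar> + 1)"
  have "\<bar>R\<bar> + 1 \<le> vnorm d x"
    unfolding vnorm_def using member_le_L2_set[of "{..<d}" 0 x] \<open>d \<ge> 1\<close> by (simp add: x_def)
  moreover have "vnorm d x \<le> R" by (rule R) (auto simp: K x_def vspace_def)
  ultimately show False by simp
qed

text \<open>A near frontier point may itself belong to \<open>K\<close>, but it is not interior, so
  an arbitrarily small further move leaves \<open>K\<close>.\<close>

lemma nearby_point_outside:
  assumes "d \<ge> 1" "K \<subseteq> vspace d" "K \<noteq> {}" "vbounded d K" and x: "x \<in> vspace d" and "R > 0"
    and not: "\<not> (x \<in> vtop d interior_of K \<and> vsetdist d x (vtop d frontier_of K) \<ge> R)"
  shows "\<exists>z\<in>vspace d - K. vdist d x z < R"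
proof (cases "x \<in> vtop d interior_of K")
  case False
  thus ?thesis using vtop_interior_iff[OF x, of K] \<open>R > 0\<close> by blast
next
  case True
  with not have "(INF z\<in>vtop d frontier_of K. vdist d x z) < R" by (simp add: vsetdist_def)
  then obtain z where z: "z \<in> vtop d frontier_of K" "vdist d x z < R"
    using vtop_frontier_nonempty[OF assms(1-4)]
    by (subst (asm) cINF_less_iff) (auto intro!: bdd_belowI2[of _ 0] simp: vdist_def L2_set_nonneg)
  have zt: "z \<in> vspace d" "z \<notin> vtop d interior_of K"
    using z(1) frontier_of_subset_topspace[of "vtop d" K] by (auto simp: vtop_def vspace_def frontier_of_def)
  have "0 < R - vdist d x z" using z(2) by simp
  then obtain y where y: "y \<in> vspace d - K" "vdist d z y < R - vdist d x z"
    using zt(2) unfolding vtop_interior_iff[OF zt(1)] by blast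
  have "vdist d x y < R" using vdist_triangle[of d x y z] y(2) by simp
  thus ?thesis using y(1) by blast
qed

subsection \<open>Time-changed Brownian motion on the line\<close>

text \<open>For \<open>w \<ge> 0\<close>, the least multiple of 1/(n+1) strictly above
  \<open>w\<close>. Strictness gives convergence from the right, as the right-continuity of
  \<open>S\<close> requires.\<close>

definition grid :: "nat \<Rightarrow> real \<Rightarrow> real" where
  "grid n w = real (Suc (nat \<lfloor>real (Suc n) * w\<rfloor>)) / real (Suc n)"

lemma grid_nonneg: "0 \<le> grid n w" by (simp add: grid_def)

lemma grid_bounds:
  assumes "0 \<le> w"
  shows "w < grid n w" "grid n w \<le> w + 1 / real (Suc n)"
proof -
  have p: "0 \<le> \<lfloor>real (Suc n) * w\<rfloor>" using assms by simp
  have "real (nat \<lfloor>real (Suc n) * w\<rfloor>) = of_int \<lfloor>real (Suc n) * w\<rfloor>"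
    using p by (metis of_nat_nat)
  hence g: "grid n w = (of_int \<lfloor>real (Suc n) * w\<rfloor> + 1) / real (Suc n)"
    by (simp add: grid_def add.commute)
  have f: "of_int \<lfloor>real (Suc n) * w\<rfloor> \<le> real (Suc n) * w"
    "real (Suc n) * w < of_int \<lfloor>real (Suc n) * w\<rfloor> + 1" by linarith+
  show "w < grid n w" unfolding g using f(2) by (simp add: pos_less_divide_eq mult.commute del: of_nat_Suc)
  have "grid n w \<le> (real (Suc n) * w + 1) / real (Suc n)"
    unfolding g by (rule divide_right_mono) (use f(1) in simp_all)
  also have "\<dots> = w + 1 / real (Suc n)" by (simp add: add_divide_distrib del: of_nat_Suc)
  finally show "grid n w \<le> w + 1 / real (Suc n)" .
qed

lemma grid_tendsto:
  assumes "0 \<le> w"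
  shows "(\<lambda>n. grid n w) \<longlonglongrightarrow> w"
proof (rule tendsto_sandwich[where f="\<lambda>_. w" and h="\<lambda>n. w + 1 / real (Suc n)"])
  show "(\<lambda>n. w + 1 / real (Suc n)) \<longlonglongrightarrow> w"
    using tendsto_add[OF tendsto_const[of w] LIMSEQ_inverse_real_of_nat]
    by (simp add: inverse_eq_divide)
qed (use grid_bounds[OF assms] in \<open>auto intro: less_imp_le always_eventually\<close>)

text \<open>The cut at 2 yields a bound beyond \<open>2 * r\<close>, twice the level finally needed;
  the surplus pays for the passage to the limit in \<open>time_change_tail\<close>.\<close>

definition gauss_tail :: real where
  "gauss_tail = measure (density lborel std_normal_density) {2..}"

lemma gauss_tail_bounds: "0 < gauss_tail" "gauss_tail \<le> 1"
proof -
  interpret N: prob_space "density lborel std_normal_density"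
    by (rule prob_space_normal_density) simp
  show "gauss_tail \<le> 1" unfolding gauss_tail_def by simp
  have "gauss_tail \<noteq> 0"
  proof
    assume "gauss_tail = 0"
    hence "{2..} \<in> null_sets (density lborel std_normal_density)"
      by (simp add: gauss_tail_def N.emeasure_eq_measure null_sets_def)
    hence "AE x in lborel. x \<in> {2..} \<longrightarrow> \<not> (0 < ennreal (std_normal_density x))"
      by (subst (asm) null_sets_density_iff) auto
    hence "AE x in lborel. x \<notin> {2::real..}"
      by (rule AE_mp) (auto simp: normal_density_pos)
    hence "emeasure lborel {2::real..} = 0"
      by (subst (asm) AE_iff_measurable[OF _ refl]) (auto simp: atLeast_def)
    moreover have "emeasure lborel {2..3::real} \<le> emeasure lborel {2::real..}"
      by (rule emeasure_mono) auto
    ultimately show False by simp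
  qed
  thus "0 < gauss_tail" unfolding gauss_tail_def
    using measure_nonneg[of "density lborel (\<lambda>x. ennreal (std_normal_density x))" "{2..}"] by linarith
qed

text \<open>Here \<open>b\<close> stands for the projection of the Brownian motion onto a unit
  vector. Independence is stated for one value of \<open>S\<close> and one value of
  \<open>b\<close>, the form in which it is used after discretisation.\<close>

locale subordinated_line = prob_space M
  for M :: "'w measure" +
  fixes Psi :: "real \<Rightarrow> real" and S b :: "real \<Rightarrow> 'w \<Rightarrow> real"
  assumes S_measurable: "\<And>t. 0 \<le> t \<Longrightarrow> S t \<in> borel_measurable M"
    and S_paths: "AE \<omega> in M. S 0 \<omega> = 0 \<and> mono_on {0..} (\<lambda>t. S t \<omega>) \<and>
      (\<forall>t\<ge>0. continuous (at_right t) (\<lambda>s. S s \<omega>))"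
    and S_laplace: "\<And>t u. 0 \<le> t \<Longrightarrow> 0 < u \<Longrightarrow> (LINT \<omega>|M. exp (- u * S t \<omega>)) = exp (- t * Psi u)"
    and b_measurable: "\<And>u. 0 \<le> u \<Longrightarrow> b u \<in> borel_measurable M"
    and b_continuous: "AE \<omega> in M. continuous_on {0..} (\<lambda>u. b u \<omega>)"
    and b_normal: "\<And>u. 0 < u \<Longrightarrow> distributed M lborel (b u) (normal_density 0 (sqrt (2 * u)))"
    and S_b_indep: "\<And>t u A C. 0 \<le> t \<Longrightarrow> 0 \<le> u \<Longrightarrow> A \<in> sets borel \<Longrightarrow> C \<in> sets borel \<Longrightarrow>
      prob ((S t -` A \<inter> space M) \<inter> (b u -` C \<inter> space M)) =
      prob (S t -` A \<inter> space M) * prob (b u -` C \<inter> space M)"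
begin

text \<open>
  Jointly measurable versions of \<open>b (S t)\<close>: the time arguments are discretised from the right,
  which turns the compositions into countable case distinctions.
\<close>

definition time_change :: "real \<Rightarrow> 'w \<Rightarrow> real" where
  "time_change t \<omega> = lim (\<lambda>n. b (grid n (S t \<omega>)) \<omega>)"

definition joint_process :: "real \<times> 'w \<Rightarrow> real" where
  "joint_process x = lim (\<lambda>m. time_change (grid m (fst x)) (snd x))"

lemma grid_time_change_measurable:
  assumes "0 \<le> t"
  shows "(\<lambda>\<omega>. b (grid n (S t \<omega>)) \<omega>) \<in> borel_measurable M"
proof -
  note S_measurable[OF assms, measurable]
  have "(\<lambda>\<omega>. b (real (Suc (nat \<lfloor>real (Suc n) * S t \<omega>\<rfloor>)) / real (Suc n)) \<omega>) \<in> borel_measurable M"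
    by (rule measurable_compose_countable[of "\<lambda>k. b (real (Suc k) / real (Suc n))"
          M borel "\<lambda>\<omega>. nat \<lfloor>real (Suc n) * S t \<omega>\<rfloor>"])
       (auto intro!: b_measurable)
  thus ?thesis by (simp add: grid_def)
qed

lemma time_change_measurable: "0 \<le> t \<Longrightarrow> time_change t \<in> borel_measurable M"
  unfolding time_change_def
  by (intro borel_measurable_lim_metric grid_time_change_measurable)

lemma joint_process_measurable: "joint_process \<in> borel_measurable (lborel \<Otimes>\<^sub>M M)"
  unfolding joint_process_def
proof (rule borel_measurable_lim_metric)
  fix n
  have "(\<lambda>x. time_change (real (Suc (nat \<lfloor>real (Suc n) * fst x\<rfloor>)) / real (Suc n)) (snd x))
      \<in> borel_measurable (lborel \<Otimes>\<^sub>M M)"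
    by (rule measurable_compose_countable[of "\<lambda>k x. time_change (real (Suc k) / real (Suc n)) (snd x)"
          "lborel \<Otimes>\<^sub>M M" borel "\<lambda>x. nat \<lfloor>real (Suc n) * fst x\<rfloor>"])
       (auto intro!: measurable_compose[OF measurable_snd time_change_measurable])
  thus "(\<lambda>x. time_change (grid n (fst x)) (snd x)) \<in> borel_measurable (lborel \<Otimes>\<^sub>M M)"
    by (simp add: grid_def)
qed

text \<open>One null set serves all times at once, so the versions may be used pathwise inside time
  integrals. Monotonicity from \<open>S 0 = 0\<close> keeps the clock in the half-line where
  \<open>b\<close> is continuous.\<close>

lemma versions_agree:
  "AE \<omega> in M. \<forall>t\<ge>0. (\<lambda>n. b (grid n (S t \<omega>)) \<omega>) \<longlonglongrightarrow> time_change t \<omega> \<and>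
     time_change t \<omega> = b (S t \<omega>) \<omega> \<and> joint_process (t, \<omega>) = b (S t \<omega>) \<omega>"
  using S_paths b_continuous
proof eventually_elim
  case (elim \<omega>)
  have nn: "0 \<le> S t \<omega>" if "0 \<le> t" for t
    using elim(1) that by (metis atLeast_iff mono_onD order_refl)
  have lim1: "(\<lambda>n. b (grid n (S t \<omega>)) \<omega>) \<longlonglongrightarrow> b (S t \<omega>) \<omega>" if "0 \<le> t" for t
    by (rule continuous_on_tendsto_compose[OF elim(2) grid_tendsto[OF nn[OF that]]])
       (use nn[OF that] grid_nonneg in auto)
  have tc: "time_change t \<omega> = b (S t \<omega>) \<omega>" if "0 \<le> t" for t
    unfolding time_change_def by (rule limI[OF lim1[OF that]])
  have jp: "joint_process (t, \<omega>) = b (S t \<omega>) \<omega>" if t: "0 \<le> t" for t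
  proof -
    have "filterlim (\<lambda>m. grid m t) (at_right t) sequentially"
      by (rule tendsto_imp_filterlim_at_right[OF grid_tendsto[OF t]])
         (auto intro!: always_eventually grid_bounds t)
    moreover have "((\<lambda>s. S s \<omega>) \<longlongrightarrow> S t \<omega>) (at_right t)"
      using elim(1) t by (auto simp: continuous_within)
    ultimately have "(\<lambda>m. S (grid m t) \<omega>) \<longlonglongrightarrow> S t \<omega>" by (rule filterlim_compose[rotated])
    hence "(\<lambda>m. b (S (grid m t) \<omega>) \<omega>) \<longlonglongrightarrow> b (S t \<omega>) \<omega>"
      by (rule continuous_on_tendsto_compose[OF elim(2)]) (use nn t grid_nonneg in auto)
    hence "(\<lambda>m. time_change (grid m t) \<omega>) \<longlonglongrightarrow> b (S t \<omega>) \<omega>" using tc grid_nonneg by simp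
    thus ?thesis by (simp add: joint_process_def limI)
  qed
  show ?case using lim1 tc jp by simp
qed

text \<open>The standard deviation \<open>sqrt (2 * u)\<close> is at least \<open>r\<close>, so a
  standardised value of at least 2 forces \<open>b u\<close> to be at least
  \<open>2 * r\<close>.\<close>

lemma gauss_tail_le:
  assumes r: "0 < r" and u: "r\<^sup>2 \<le> u"
  shows "gauss_tail \<le> prob (b u -` {2 * r..} \<inter> space M)"
proof -
  have upos: "0 < u" using r u by (smt (verit) zero_less_power)
  define Z where "Z = (\<lambda>\<omega>. (b u \<omega> - 0) / sqrt (2 * u))"
  have "distributed M lborel Z std_normal_density"
    unfolding Z_def
    using b_normal[OF upos] upos by (subst (asm) normal_standard_normal_convert) auto
  hence Z: "distr M lborel Z = density lborel std_normal_density" "Z \<in> measurable M lborel"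
    by (auto simp: distributed_def)
  have "gauss_tail = prob (Z -` {2..} \<inter> space M)"
    unfolding gauss_tail_def Z(1)[symmetric] by (subst measure_distr[OF Z(2)]) auto
  also have "\<dots> \<le> prob (b u -` {2 * r..} \<inter> space M)"
  proof (rule finite_measure_mono)
    have "r \<le> sqrt u" using r u by (simp add: real_le_rsqrt)
    also have "\<dots> \<le> sqrt (2 * u)" using upos by simp
    finally have rs: "r \<le> sqrt (2 * u)" .
    show "Z -` {2..} \<inter> space M \<subseteq> b u -` {2 * r..} \<inter> space M"
    proof
      fix \<omega> assume w: "\<omega> \<in> Z -` {2..} \<inter> space M"
      hence "2 * sqrt (2 * u) \<le> b u \<omega>"
        using upos by (auto simp: Z_def pos_le_divide_eq)
      thus "\<omega> \<in> b u -` {2 * r..} \<inter> space M" using w rs by auto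
    qed
    show "b u -` {2 * r..} \<inter> space M \<in> events"
      by (rule measurable_sets[OF b_measurable]) (use upos in auto)
  qed
  finally show ?thesis .
qed

text \<open>On each piece \<open>A k\<close> the rounded clock is a constant, so the event
  factorises by independence; the pieces are then summed.\<close>

lemma grid_time_change_tail:
  assumes t: "0 \<le> t" and r: "0 < r"
  shows "gauss_tail * prob (S t -` {r\<^sup>2..} \<inter> space M) \<le>
    prob ((\<lambda>\<omega>. b (grid n (S t \<omega>)) \<omega>) -` {2 * r..} \<inter> space M)"
proof -
  define B where "B k = {w::real. nat \<lfloor>real (Suc n) * w\<rfloor> = k \<and> r\<^sup>2 \<le> w}" for k
  define A where "A k = S t -` B k \<inter> space M" for k
  define C where "C k = b (real (Suc k) / real (Suc n)) -` {2 * r..} \<inter> space M" for k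
  have B: "B k \<in> sets borel" for k unfolding B_def by measurable
  have A: "A k \<in> events" for k
    unfolding A_def by (rule measurable_sets[OF S_measurable[OF t] B])
  have C: "C k \<in> events" for k
    unfolding C_def by (rule measurable_sets[OF b_measurable]) auto
  have "disjoint_family A" "disjoint_family (\<lambda>k. A k \<inter> C k)"
    by (auto simp: disjoint_family_on_def A_def B_def)
  hence sums: "(\<lambda>k. prob (A k)) sums prob (\<Union>k. A k)"
      "(\<lambda>k. prob (A k \<inter> C k)) sums prob (\<Union>k. A k \<inter> C k)"
    using A C by (auto intro!: finite_measure_UNION)
  have "gauss_tail * prob (A k) \<le> prob (A k \<inter> C k)" for k
  proof (cases "A k = {}")
    case False
    \<comment> \<open>A single point of \<open>A k\<close> suffices: the rounded time is common to
      the piece and exceeds this point's clock value, which is at least the square of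
      \<open>r\<close>.\<close>
    then obtain \<omega> where w: "nat \<lfloor>real (Suc n) * S t \<omega>\<rfloor> = k" "r\<^sup>2 \<le> S t \<omega>"
      by (auto simp: A_def B_def)
    have "r\<^sup>2 \<le> real (Suc k) / real (Suc n)"
      using grid_bounds(1)[of "S t \<omega>" n] w(2) order_trans[OF zero_le_power2 w(2)]
      unfolding grid_def w(1) by linarith
    hence "gauss_tail \<le> prob (C k)" unfolding C_def by (rule gauss_tail_le[OF r])
    moreover have "prob (A k \<inter> C k) = prob (A k) * prob (C k)"
      unfolding A_def C_def by (rule S_b_indep[OF t _ B]) auto
    ultimately show ?thesis by (metis mult.commute measure_nonneg mult_left_mono)
  qed simp
  hence "gauss_tail * prob (\<Union>k. A k) \<le> prob (\<Union>k. A k \<inter> C k)"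
    by (rule sums_le[OF _ sums_mult[OF sums(1)] sums(2)])
  also have "(\<Union>k. A k) = S t -` {r\<^sup>2..} \<inter> space M" by (auto simp: A_def B_def)
  also have "prob (\<Union>k. A k \<inter> C k) \<le> prob ((\<lambda>\<omega>. b (grid n (S t \<omega>)) \<omega>) -` {2 * r..} \<inter> space M)"
  proof (rule finite_measure_mono)
    show "(\<lambda>\<omega>. b (grid n (S t \<omega>)) \<omega>) -` {2 * r..} \<inter> space M \<in> events"
      by (rule measurable_sets[OF grid_time_change_measurable[OF t]]) auto
  qed (auto simp: A_def B_def C_def grid_def)
  finally show ?thesis .
qed

text \<open>The ramp \<open>h\<close> lies between the indicators of [2r, infinity) and (r,
  infinity) and is continuous, so dominated convergence carries the grid estimate to the
  limit.\<close>

lemma time_change_tail: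
  assumes t: "0 \<le> t" and r: "0 < r"
  shows "gauss_tail * prob (S t -` {r\<^sup>2..} \<inter> space M) \<le> prob {\<omega>\<in>space M. r < time_change t \<omega>}"
proof -
  define h where "h x = max 0 (min 1 ((x - r) / r))" for x :: real
  define f where "f n \<omega> = b (grid n (S t \<omega>)) \<omega>" for n \<omega>
  have f: "f n \<in> borel_measurable M" for n
    unfolding f_def by (rule grid_time_change_measurable[OF t])
  note [measurable] = f time_change_measurable[OF t]
  have h[measurable]: "h \<in> borel_measurable borel" unfolding h_def by measurable
  have cont: "isCont h x" for x
    unfolding h_def using r by (intro continuous_intros) auto
  have h01: "0 \<le> h x" "h x \<le> 1" for x by (auto simp: h_def)
  have "(\<lambda>n. LINT \<omega>|M. h (f n \<omega>)) \<longlonglongrightarrow> (LINT \<omega>|M. h (time_change t \<omega>))"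
  proof (rule integral_dominated_convergence[where w="\<lambda>_. 1"])
    show "AE \<omega> in M. (\<lambda>n. h (f n \<omega>)) \<longlonglongrightarrow> h (time_change t \<omega>)"
      using versions_agree by eventually_elim (use t in \<open>auto intro!: isCont_tendsto_compose[OF cont] simp: f_def\<close>)
  qed (use h01 in auto)
  moreover have "gauss_tail * prob (S t -` {r\<^sup>2..} \<inter> space M) \<le> (LINT \<omega>|M. h (f n \<omega>))" for n
  proof -
    have "gauss_tail * prob (S t -` {r\<^sup>2..} \<inter> space M) \<le> prob (f n -` {2 * r..} \<inter> space M)"
      unfolding f_def by (rule grid_time_change_tail[OF t r])
    also have "\<dots> = (LINT \<omega>|M. indicator (f n -` {2 * r..} \<inter> space M) \<omega>)" by simp
    also have "\<dots> \<le> (LINT \<omega>|M. h (f n \<omega>))"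
    proof (rule integral_mono)
      show "integrable M (\<lambda>\<omega>. h (f n \<omega>))"
        by (rule integrable_const_bound[of _ 1]) (use h01 in auto)
      show "integrable M (indicator (f n -` {2 * r..} \<inter> space M) :: _ \<Rightarrow> real)"
        by (rule integrable_real_indicator) (auto simp: emeasure_eq_measure)
    qed (use r in \<open>auto simp: h_def indicator_def pos_le_divide_eq\<close>)
    finally show ?thesis .
  qed
  ultimately have "gauss_tail * prob (S t -` {r\<^sup>2..} \<inter> space M) \<le> (LINT \<omega>|M. h (time_change t \<omega>))"
    by (intro LIMSEQ_le_const) auto
  also have "\<dots> \<le> (LINT \<omega>|M. indicator {\<omega>\<in>space M. r < time_change t \<omega>} \<omega>)"
  proof (rule integral_mono)
    show "integrable M (\<lambda>\<omega>. h (time_change t \<omega>))"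
      by (rule integrable_const_bound[of _ 1]) (use h01 in auto)
    show "integrable M (indicator {\<omega>\<in>space M. r < time_change t \<omega>} :: _ \<Rightarrow> real)"
      by (rule integrable_real_indicator) (auto simp: emeasure_eq_measure)
  qed (use r in \<open>auto simp: h_def indicator_def pos_divide_le_eq\<close>)
  also have "\<dots> = prob {\<omega>\<in>space M. r < time_change t \<omega>}"
    using time_change_measurable[OF t] by simp
  finally show ?thesis .
qed

section \<open>Tail of the subordinator and time spent beyond a level\<close>

text \<open>Exponential Markov inequality at the inverse square of \<open>r\<close>: where
  \<open>S t\<close> is below the square of \<open>r\<close>, the Laplace integrand exceeds exp(-1),
  while its mean is at most exp(-2). The quotient exp(-1) is below 1/2.\<close>

lemma S_tail:
  assumes t: "0 \<le> t" and r: "0 < r" and big: "2 \<le> t * Psi (1 / r\<^sup>2)"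
  shows "1 / 2 \<le> prob (S t -` {r\<^sup>2..} \<inter> space M)"
proof -
  define u where "u = 1 / r\<^sup>2"
  have u: "0 < u" using r by (simp add: u_def)
  note [measurable] = S_measurable[OF t]
  define A where "A = S t -` {..<r\<^sup>2} \<inter> space M"
  have A[measurable]: "A \<in> events" unfolding A_def by measurable
  \<comment> \<open>Integrability is read off from the value: a non-integrable function has integral
    0, whereas the Laplace transform is an exponential.\<close>
  have int: "integrable M (\<lambda>\<omega>. exp (- u * S t \<omega>))"
    using S_laplace[OF t u] not_integrable_integral_eq by (metis exp_not_eq_zero)
  have "exp (-1) * prob A = (LINT \<omega>|M. exp (-1) * indicator A \<omega>)" by (simp add: A)
  also have "\<dots> \<le> (LINT \<omega>|M. exp (- u * S t \<omega>))"
  proof (rule integral_mono[OF _ int])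
    show "integrable M (\<lambda>\<omega>. exp (-1) * indicator A \<omega> :: real)"
      by (intro integrable_mult_right integrable_real_indicator A) (simp add: emeasure_eq_measure)
    show "exp (-1) * indicator A \<omega> \<le> exp (- u * S t \<omega>)" for \<omega>
      using r by (auto simp: A_def indicator_def u_def pos_divide_le_eq)
  qed
  also have "\<dots> = exp (- t * Psi u)" by (rule S_laplace[OF t u])
  also have "\<dots> \<le> exp (-2)" using big by (simp add: u_def)
  finally have "prob A \<le> exp (-2) / exp (-1)" by (simp add: pos_le_divide_eq mult.commute)
  also have "\<dots> = exp (-1)" by (simp add: exp_diff[symmetric])
  also have "\<dots> \<le> 1 / 2"
    using exp_ge_add_one_self[of 1] by (simp add: exp_minus field_simps)
  finally have "prob A \<le> 1 / 2" .
  moreover have "prob (space M - A) = 1 - prob A" by (rule prob_compl[OF A])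
  moreover have "space M - A = S t -` {r\<^sup>2..} \<inter> space M" by (auto simp: A_def)
  ultimately show ?thesis by simp
qed

text \<open>Built on \<open>joint_process\<close>, and on a level instead of \<open>K\<close>, so
  that the underlying set in time and sample is measurable and Tonelli applies.\<close>

definition occupation :: "real \<Rightarrow> real \<Rightarrow> 'w \<Rightarrow> real" where
  "occupation T r \<omega> = measure lborel {s\<in>{0..T}. r < joint_process (s, \<omega>)}"

lemma occupation_set:
  assumes "\<omega> \<in> space M"
  shows "{s\<in>{0..T}. r < joint_process (s, \<omega>)} \<in> sets lborel"
proof -
  note [measurable] = measurable_compose[OF measurable_Pair2'[OF assms] joint_process_measurable]
  show ?thesis by measurable
qed

lemma occupation_bounds:
  assumes "0 \<le> T" "\<omega> \<in> space M"
  shows "0 \<le> occupation T r \<omega>" "occupation T r \<omega> \<le> T"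
    "emeasure lborel {s\<in>{0..T}. r < joint_process (s, \<omega>)} = ennreal (occupation T r \<omega>)"
proof -
  have "emeasure lborel {s\<in>{0..T}. r < joint_process (s, \<omega>)} \<le> emeasure lborel {0..T}"
    by (rule emeasure_mono) auto
  hence le: "emeasure lborel {s\<in>{0..T}. r < joint_process (s, \<omega>)} \<le> ennreal T"
    using assms(1) by simp
  show nn: "0 \<le> occupation T r \<omega>" by (simp add: occupation_def)
  show eq: "emeasure lborel {s\<in>{0..T}. r < joint_process (s, \<omega>)} = ennreal (occupation T r \<omega>)"
    unfolding occupation_def by (rule emeasure_eq_ennreal_measure) (use le in \<open>auto simp: top_unique\<close>)
  show "occupation T r \<omega> \<le> T" using le assms(1) unfolding eq by simp
qed

text \<open>Both facts come from slicing \<open>E\<close>: slices at a fixed sample give the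
  occupation time, slices at a fixed time give tail probabilities. The lower bound keeps only the
  times in the second half of the interval.\<close>

lemma occupation_measurable: "occupation T r \<in> borel_measurable M"
  and occupation_lower:
    "\<lbrakk>0 \<le> T; 0 \<le> a; \<And>s. s \<in> {T/2..T} \<Longrightarrow> a \<le> prob {\<omega>\<in>space M. r < time_change s \<omega>}\<rbrakk>
      \<Longrightarrow> a * (T / 2) \<le> (LINT \<omega>|M. occupation T r \<omega>)"
proof -
  define E where "E = {x\<in>space (lborel \<Otimes>\<^sub>M M). fst x \<in> {0..T} \<and> r < joint_process x}"
  note [measurable] = joint_process_measurable
  have E[measurable]: "E \<in> sets (lborel \<Otimes>\<^sub>M M)" unfolding E_def by measurable
  interpret P: pair_sigma_finite lborel M
    by (intro pair_sigma_finite.intro sigma_finite_lborel sigma_finite_measure_axioms)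
  have sec: "(\<lambda>s. (s, \<omega>)) -` E = {s\<in>{0..T}. r < joint_process (s, \<omega>)}" if "\<omega> \<in> space M" for \<omega>
    using that by (auto simp: E_def space_pair_measure)
  have m: "(\<lambda>\<omega>. emeasure lborel ((\<lambda>s. (s, \<omega>)) -` E)) \<in> borel_measurable M"
    by (rule P.measurable_emeasure_Pair2[OF E])
  hence "(\<lambda>\<omega>. enn2real (emeasure lborel ((\<lambda>s. (s, \<omega>)) -` E))) \<in> borel_measurable M" by measurable
  thus meas: "occupation T r \<in> borel_measurable M"
    by (rule measurable_cong[THEN iffD1, rotated]) (simp add: occupation_def measure_def sec)
  assume T: "0 \<le> T" and a: "0 \<le> a"
    and low: "\<And>s. s \<in> {T/2..T} \<Longrightarrow> a \<le> prob {\<omega>\<in>space M. r < time_change s \<omega>}"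
  have int: "integrable M (occupation T r)"
    by (rule integrable_const_bound[of _ T]) (use occupation_bounds[OF T] meas in auto)
  have "ennreal (a * (T / 2)) = (\<integral>\<^sup>+s. ennreal a * indicator {T/2..T} s \<partial>lborel)"
    using T a by (subst nn_integral_cmult_indicator) (auto simp: ennreal_mult'[symmetric])
  also have "\<dots> \<le> (\<integral>\<^sup>+s. emeasure M (Pair s -` E) \<partial>lborel)"
  proof (rule nn_integral_mono)
    fix s :: real
    show "ennreal a * indicator {T/2..T} s \<le> emeasure M (Pair s -` E)"
    proof (cases "s \<in> {T/2..T}")
      case True
      hence s: "0 \<le> s" "s \<le> T" using T by auto
      \<comment> \<open>The slice of \<open>E\<close> is written with \<open>joint_process\<close>,
        the hypothesis with \<open>time_change\<close>; at a fixed time they agree almost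
        surely.\<close>
      have "emeasure M {\<omega>\<in>space M. r < time_change s \<omega>} = emeasure M (Pair s -` E)"
      proof (rule emeasure_eq_AE)
        show "AE \<omega> in M. (\<omega> \<in> {\<omega>\<in>space M. r < time_change s \<omega>}) = (\<omega> \<in> Pair s -` E)"
          using versions_agree by eventually_elim (use s in \<open>auto simp: E_def space_pair_measure\<close>)
        show "{\<omega>\<in>space M. r < time_change s \<omega>} \<in> events"
          using time_change_measurable[OF s(1)] by measurable
        show "Pair s -` E \<in> events" by (rule sets_Pair1[OF E])
      qed
      thus ?thesis using low[OF True] True by (simp add: emeasure_eq_measure)
    qed simp
  qed
  also have "\<dots> = emeasure (lborel \<Otimes>\<^sub>M M) E" by (rule emeasure_pair_measure_alt[OF E, symmetric])
  also have "\<dots> = (\<integral>\<^sup>+\<omega>. emeasure lborel ((\<lambda>s. (s, \<omega>)) -` E) \<partial>M)"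
    by (rule P.emeasure_pair_measure_alt2[OF E])
  also have "\<dots> = (\<integral>\<^sup>+\<omega>. ennreal (occupation T r \<omega>) \<partial>M)"
    by (rule nn_integral_cong) (simp only: sec occupation_bounds(3)[OF T])
  also have "\<dots> = ennreal (LINT \<omega>|M. occupation T r \<omega>)"
    by (rule nn_integral_eq_integral[OF int]) (use occupation_bounds[OF T] in auto)
  finally show "a * (T / 2) \<le> (LINT \<omega>|M. occupation T r \<omega>)"
    by (rule ennreal_le_iff[THEN iffD1, rotated])
       (auto intro!: integral_nonneg_AE simp: occupation_bounds[OF T])
qed

end

subsection \<open>The maximum of an eigenfunction\<close>

text \<open>\<open>the_inv_into\<close> is informative only for an injective function and a value in
  its range. Scaling makes \<open>Psi\<close> unbounded. By concavity a derivative vanishing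
  somewhere would stay non-positive afterwards and bound \<open>Psi\<close>; so \<open>Psi\<close>
  increases strictly, and the limit 0 at the origin gives all positive values.\<close>

lemma bernstein_inverse:
  assumes bern: "bernstein0 Psi" and nz: "\<exists>u>0. Psi u \<noteq> 0"
    and scal: "\<exists>mu>0. \<exists>c. 0 < c \<and> c \<le> 1 \<and> lower_scaling Psi mu c" and y: "0 < y"
  shows "0 < the_inv_into {0<..} Psi y" "Psi (the_inv_into {0<..} Psi y) = y"
proof -
  have diff: "(deriv ^^ n) Psi field_differentiable at u" if "0 < u" for n u
    using bern that by (auto simp: bernstein0_def)
  have D1: "DERIV Psi u :> deriv Psi u" if "0 < u" for u
    using diff[OF that, of 0] by (simp add: DERIV_deriv_iff_field_differentiable)
  have D2: "DERIV (deriv Psi) u :> (deriv ^^ 2) Psi u" if "0 < u" for u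
    using diff[OF that, of 1] by (simp add: DERIV_deriv_iff_field_differentiable numeral_2_eq_2)
  have sgn: "(-1) ^ n * (deriv ^^ n) Psi u \<le> 0" if "1 \<le> n" "0 < u" for n u
    using bern that unfolding bernstein0_def by blast
  have D1_nonneg: "0 \<le> deriv Psi u" if "0 < u" for u using sgn[of 1, OF _ that] by simp
  have D2_nonpos: "(deriv ^^ 2) Psi u \<le> 0" if "0 < u" for u using sgn[of 2, OF _ that] by simp
  have mono: "Psi a \<le> Psi b" if "0 < a" "a \<le> b" for a b
    by (rule DERIV_nonneg_imp_nondecreasing[OF that(2)])
       (use D1 D1_nonneg that in \<open>meson less_le_trans\<close>)
  obtain u0 where u0: "0 < u0" "0 < Psi u0"
    using nz bern unfolding bernstein0_def by (metis order_le_less)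
  obtain mu c where mc: "0 < mu" "0 < c" "lower_scaling Psi mu c" using scal by blast
  have unbounded: "\<exists>b>0. C < Psi b" for C
  proof -
    \<comment> \<open>Chosen so that \<open>c * X * Psi u0\<close> exceeds \<open>C\<close>; the
      maximum with 1 makes \<open>g\<close> an admissible scaling factor.\<close>
    define X where "X = max 1 ((\<bar>C\<bar> + 1) / (c * Psi u0))"
    define g where "g = X powr (1 / mu)"
    have g: "1 \<le> g" "g powr mu = X"
      using mc by (auto simp: g_def X_def powr_powr intro: ge_one_powr_ge_zero)
    have "C < \<bar>C\<bar> + 1" by linarith
    also have "\<dots> = (\<bar>C\<bar> + 1) / (c * Psi u0) * (c * Psi u0)" using mc u0 by simp
    also have "\<dots> \<le> X * (c * Psi u0)" by (rule mult_right_mono) (use mc u0 in \<open>auto simp: X_def\<close>)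
    also have "\<dots> = c * g powr mu * Psi u0" using g by simp
    also have "\<dots> \<le> Psi (g * u0)" using mc(3) u0 g(1) unfolding lower_scaling_def by blast
    finally show ?thesis using u0 g(1) by (intro exI[of _ "g * u0"]) auto
  qed
  have D1_pos: "0 < deriv Psi a" if a: "0 < a" for a
  proof (rule ccontr)
    assume "\<not> 0 < deriv Psi a"
    hence le0: "deriv Psi a \<le> 0" by simp
    have dec: "deriv Psi x \<le> 0" if x: "a \<le> x" for x
    proof -
      have "deriv Psi x \<le> deriv Psi a"
        by (rule DERIV_nonpos_imp_nonincreasing[OF x])
           (use D2 D2_nonpos a in \<open>meson less_le_trans\<close>)
      thus ?thesis using le0 by simp
    qed
    obtain b where b: "0 < b" "Psi a < Psi b" using unbounded by blast
    have ab: "a \<le> b" using mono[OF b(1), of a] b(2) by linarith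
    have "Psi b \<le> Psi a"
      by (rule DERIV_nonpos_imp_nonincreasing[OF ab])
         (use D1 dec a in \<open>meson less_le_trans\<close>)
    thus False using b(2) by simp
  qed
  have strict: "Psi a < Psi b" if "0 < a" "a < b" for a b
    by (rule DERIV_pos_imp_increasing[OF that(2)])
       (use D1 D1_pos that in \<open>meson less_le_trans\<close>)
  have inj: "inj_on Psi {0<..}"
    by (rule inj_onI) (metis greaterThan_iff linorder_neqE_linordered_idom order_less_irrefl strict)
  have "(Psi \<longlongrightarrow> 0) (at_right 0)" using bern by (simp add: bernstein0_def)
  hence "eventually (\<lambda>u. Psi u < y) (at_right 0)" using y by (rule order_tendstoD)
  then obtain h where h: "0 < h" "\<And>u. 0 < u \<Longrightarrow> u < h \<Longrightarrow> Psi u < y"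
    by (auto simp: eventually_at_right_field)
  obtain b where b: "0 < b" "y < Psi b" using unbounded by blast
  have hy: "Psi (h / 2) < y" using h by simp
  have hb: "h / 2 \<le> b" using mono[OF b(1), of "h / 2"] b(2) hy by linarith
  have "\<exists>x\<ge>h / 2. x \<le> b \<and> Psi x = y"
    by (rule IVT'[OF _ _ hb])
       (use hy b h in \<open>auto intro!: less_imp_le continuous_at_imp_continuous_on DERIV_isCont[OF D1]\<close>)
  then obtain x where "h / 2 \<le> x" "Psi x = y" by blast
  hence x: "0 < x" "Psi x = y" using h by auto
  have "the_inv_into {0<..} Psi y = x"
    using the_inv_into_f_f[OF inj, of x] x by simp
  thus "0 < the_inv_into {0<..} Psi y" "Psi (the_inv_into {0<..} Psi y) = y" using x by auto
qed

section \<open>Gaussian projections of the Brownian motion\<close>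

lemma normal_unit_combination:
  fixes e :: "nat \<Rightarrow> real" and \<sigma> :: real
  assumes e: "(\<Sum>i<d. (e i)\<^sup>2) = 1" and \<sigma>: "0 < \<sigma>"
  shows "distributed (\<Pi>\<^sub>M i\<in>{..<d}. density lborel (\<lambda>x. ennreal (normal_density 0 \<sigma> x))) lborel
    (\<lambda>x. \<Sum>i<d. e i * x i) (normal_density 0 \<sigma>)"
proof -
  let ?N = "density lborel (\<lambda>x. ennreal (normal_density 0 \<sigma> x))"
  let ?P = "\<Pi>\<^sub>M i\<in>{..<d}. ?N"
  interpret N: prob_space ?N by (rule prob_space_normal_density[OF \<sigma>])
  interpret P: prob_space ?P by (rule prob_space_PiM) (rule N.prob_space_axioms)
  \<comment> \<open>Vanishing coefficients are dropped, since the sum rule for independent normals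
    wants positive standard deviations.\<close>
  define J where "J = {i\<in>{..<d}. e i \<noteq> 0}"
  have "(\<Sum>i\<in>J. (e i)\<^sup>2) = (\<Sum>i<d. (e i)\<^sup>2)"
    by (rule sum.mono_neutral_left) (auto simp: J_def)
  hence eJ: "(\<Sum>i\<in>J. (e i)\<^sup>2) = 1" using e by simp
  hence "J \<noteq> {}" by (metis sum.empty zero_neq_one)
  hence J: "finite J" "J \<noteq> {}" "J \<subseteq> {..<d}" by (auto simp: J_def)
  have d: "{..<d} \<noteq> {}" using J by auto
  have comp: "(\<lambda>x. x i) \<in> measurable ?P ?N" if "i < d" for i
    using that by (intro measurable_component_singleton) auto
  have "P.indep_vars (\<lambda>_. ?N) (\<lambda>i x. x i) {..<d}"
  proof (subst P.indep_vars_iff_distr_eq_PiM'[OF d])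
    show "(\<lambda>x. x i) \<in> measurable ?P ?N" if "i \<in> {..<d}" for i using comp that by simp
    have "distr ?P ?P (\<lambda>x. \<lambda>i\<in>{..<d}. x i) = distr ?P ?P (\<lambda>x. x)"
      by (rule distr_cong) (auto simp: space_PiM PiE_restrict)
    also have "\<dots> = ?P" by simp
    also have "\<dots> = (\<Pi>\<^sub>M i\<in>{..<d}. distr ?P ?N (\<lambda>x. x i))"
      by (intro PiM_cong refl distr_PiM_component[symmetric] N.prob_space_axioms)
    finally show "distr ?P ?P (\<lambda>x. \<lambda>i\<in>{..<d}. x i) = (\<Pi>\<^sub>M i\<in>{..<d}. distr ?P ?N (\<lambda>x. x i))" .
  qed
  hence "P.indep_vars (\<lambda>_. borel) (\<lambda>i. (\<lambda>z. e i * z) \<circ> (\<lambda>x. x i)) {..<d}"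
    by (rule P.indep_vars_compose) measurable
  hence ind: "P.indep_vars (\<lambda>_. borel) (\<lambda>i x. e i * x i) J"
    using J(3) by (auto simp: comp_def intro: P.indep_vars_subset)
  have dist: "distributed ?P lborel (\<lambda>x. e i * x i) (normal_density 0 (\<bar>e i\<bar> * \<sigma>))" if i: "i \<in> J" for i
  proof -
    have "i < d" using i by (auto simp: J_def)
    have "distr ?P lborel (\<lambda>x. x i) = distr ?P ?N (\<lambda>x. x i)" by (rule distr_cong) auto
    also have "\<dots> = ?N" using \<open>i < d\<close> by (intro distr_PiM_component N.prob_space_axioms) auto
    finally have "distributed ?P lborel (\<lambda>x. x i) (normal_density 0 \<sigma>)"
      using comp[OF \<open>i < d\<close>] by (auto simp: distributed_def)
    from P.normal_density_affine[OF this \<sigma>, of "e i" 0] i show ?thesis by (simp add: J_def)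
  qed
  have "distributed ?P lborel (\<lambda>x. \<Sum>i\<in>J. e i * x i)
      (normal_density (\<Sum>i\<in>J. 0) (sqrt (\<Sum>i\<in>J. (\<bar>e i\<bar> * \<sigma>)\<^sup>2)))"
    by (rule P.sum_indep_normal[OF J(1,2) ind _ dist]) (use \<sigma> in \<open>auto simp: J_def\<close>)
  moreover have "sqrt (\<Sum>i\<in>J. (\<bar>e i\<bar> * \<sigma>)\<^sup>2) = \<sigma>"
    using \<sigma> eJ by (simp add: power_mult_distrib sum_distrib_right[symmetric])
  moreover have "(\<lambda>x. \<Sum>i\<in>J. e i * x i) = (\<lambda>x. \<Sum>i<d. e i * x i)"
    by (rule ext, rule sum.mono_neutral_left) (auto simp: J_def)
  ultimately show ?thesis by simp
qed

lemma subordinated_line_of_setting: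
  assumes setting: "subordinate_setting M Psi d S B" and e: "(\<Sum>i<d. (e i)\<^sup>2) = 1"
  shows "subordinated_line M Psi S (\<lambda>u \<omega>. \<Sum>i<d. e i * B u \<omega> i)"
proof -
  interpret prob_space M using setting by (simp add: subordinate_setting_def)
  have sub: "subordinator M Psi S" and bm: "fast_brownian M d B" and ind: "independent_processes M d S B"
    using setting by (auto simp: subordinate_setting_def)
  have B: "B u \<in> measurable M (vborel d)" if "0 \<le> u" for u
    using bm that by (simp add: fast_brownian_def)
  have lin[measurable]: "(\<lambda>x. \<Sum>i<d. e i * x i) \<in> borel_measurable (vborel d)"
    unfolding vborel_def by measurable
  have b: "(\<lambda>\<omega>. \<Sum>i<d. e i * B u \<omega> i) \<in> borel_measurable M" if "0 \<le> u" for u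
    using measurable_compose[OF B[OF that] lin] .
  have S: "S t \<in> borel_measurable M" if "0 \<le> t" for t
    using sub that by (simp add: subordinator_def)
  have B0: "AE \<omega> in M. \<forall>i<d. B 0 \<omega> i = 0 \<and> continuous_on {0..} (\<lambda>t. B t \<omega> i)"
    using bm by (simp add: fast_brownian_def)
  show ?thesis
  proof
    show "AE \<omega> in M. S 0 \<omega> = 0 \<and> mono_on {0..} (\<lambda>t. S t \<omega>) \<and>
        (\<forall>t\<ge>0. continuous (at_right t) (\<lambda>s. S s \<omega>))"
      using sub by (simp add: subordinator_def)
    show "(LINT \<omega>|M. exp (- u * S t \<omega>)) = exp (- t * Psi u)" if "0 \<le> t" "0 < u" for t u
      using sub that unfolding subordinator_def by blast
    show "AE \<omega> in M. continuous_on {0..} (\<lambda>u. \<Sum>i<d. e i * B u \<omega> i)"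
      using B0 by eventually_elim (auto intro!: continuous_intros)
  next
    fix u :: real assume u: "0 < u"
    \<comment> \<open>The law is prescribed for increments only; the one from time 0 equals
      \<open>B u\<close> almost surely in every coordinate.\<close>
    define inc where "inc = (\<lambda>\<omega>. \<lambda>i\<in>{..<d}. B u \<omega> i - B 0 \<omega> i)"
    let ?P = "\<Pi>\<^sub>M i\<in>{..<d}. density lborel (\<lambda>x. ennreal (normal_density 0 (sqrt (2 * u)) x))"
    have "inc \<in> measurable M (vborel d)"
      unfolding inc_def vborel_def
      by (intro measurable_restrict borel_measurable_diff)
         (use B[of u] B[of 0] u in \<open>auto simp: vborel_def intro: measurable_compose[OF _ measurable_component_singleton]\<close>)
    note inc[measurable] = this
    have "distr M (vborel d) inc = ?P"
    proof -
      have "\<forall>s t. 0 \<le> s \<and> s < t \<longrightarrow>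
          distr M (vborel d) (\<lambda>\<omega>. \<lambda>i\<in>{..<d}. B t \<omega> i - B s \<omega> i) =
          (\<Pi>\<^sub>M i\<in>{..<d}. density lborel (\<lambda>x. ennreal (normal_density 0 (sqrt (2 * (t - s))) x)))"
        using bm unfolding fast_brownian_def by blast
      from this[rule_format, of 0 u] show ?thesis using u by (simp add: inc_def)
    qed
    moreover have "distr M lborel (\<lambda>\<omega>. \<Sum>i<d. e i * B u \<omega> i) = distr M lborel (\<lambda>\<omega>. \<Sum>i<d. e i * inc \<omega> i)"
    proof (rule distr_cong_AE)
      show "AE \<omega> in M. (\<Sum>i<d. e i * B u \<omega> i) = (\<Sum>i<d. e i * inc \<omega> i)"
        using B0 by eventually_elim (auto simp: inc_def)
    qed (use b[of u] u measurable_compose[OF inc lin] in auto)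
    moreover have "distr M lborel (\<lambda>\<omega>. \<Sum>i<d. e i * inc \<omega> i) =
        distr (distr M (vborel d) inc) lborel (\<lambda>x. \<Sum>i<d. e i * x i)"
      by (subst distr_distr) (auto simp: comp_def)
    moreover have "distr ?P lborel (\<lambda>x. \<Sum>i<d. e i * x i) = density lborel (normal_density 0 (sqrt (2 * u)))"
      using normal_unit_combination[OF e, of "sqrt (2 * u)"] u by (simp add: distributed_def)
    ultimately show "distributed M lborel (\<lambda>\<omega>. \<Sum>i<d. e i * B u \<omega> i) (normal_density 0 (sqrt (2 * u)))"
      using b[of u] u by (auto simp: distributed_def)
  next
    fix t u :: real and A C :: "real set"
    assume t: "0 \<le> t" and u: "0 \<le> u" and AC: "A \<in> sets borel" "C \<in> sets borel"
    \<comment> \<open>Independence concerns the sigma-algebras generated by the whole processes;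
      evaluation at one time is measurable with respect to each of them.\<close>
    let ?VS = "vimage_algebra (space M) (\<lambda>\<omega>. \<lambda>t\<in>{0..}. S t \<omega>) (\<Pi>\<^sub>M t\<in>{0..}. borel)"
    let ?VB = "vimage_algebra (space M) (\<lambda>\<omega>. \<lambda>t\<in>{0..}. B t \<omega>) (\<Pi>\<^sub>M t\<in>{0..}. vborel d)"
    have "(\<lambda>\<omega>. \<lambda>t\<in>{0..}. S t \<omega>) \<in> measurable ?VS (\<Pi>\<^sub>M t\<in>{0..}. borel)"
      by (rule measurable_vimage_algebra1) (auto simp: space_PiM)
    from measurable_compose[OF this measurable_component_singleton[of t]]
    have "S t \<in> measurable ?VS borel" using t by simp
    from measurable_sets[OF this AC(1)] have 1: "S t -` A \<inter> space M \<in> sets ?VS" by simp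
    have "(\<lambda>\<omega>. \<lambda>t\<in>{0..}. B t \<omega>) \<in> measurable ?VB (\<Pi>\<^sub>M t\<in>{0..}. vborel d)"
      by (rule measurable_vimage_algebra1) (use measurable_space[OF B] in \<open>auto simp: space_PiM\<close>)
    from measurable_compose[OF this measurable_component_singleton[of u]]
    have "B u \<in> measurable ?VB (vborel d)" using u by simp
    from measurable_sets[OF measurable_compose[OF this lin] AC(2)]
    have 2: "(\<lambda>\<omega>. \<Sum>i<d. e i * B u \<omega> i) -` C \<inter> space M \<in> sets ?VB" by simp
    show "prob ((S t -` A \<inter> space M) \<inter> ((\<lambda>\<omega>. \<Sum>i<d. e i * B u \<omega> i) -` C \<inter> space M)) =
        prob (S t -` A \<inter> space M) * prob ((\<lambda>\<omega>. \<Sum>i<d. e i * B u \<omega> i) -` C \<inter> space M)"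
      using ind[unfolded independent_processes_def] 1 2 by (rule indep_setD)
  qed (use b S in auto)
qed

section \<open>The Feynman-Kac estimate at the maximum\<close>

text \<open>By convexity the graph lies below its chord over [0,1], whose slope 1/e - 1 is less than
  -1/2. It linearises the weight, so that only a mean has to be estimated.\<close>

lemma exp_minus_le_chord:
  fixes x :: real
  assumes "0 \<le> x" "x \<le> 1"
  shows "exp (- x) \<le> 1 - x / 2"
proof -
  have "x * x \<le> x" using assms by (simp add: mult_left_le)
  hence "1 \<le> (1 - x / 2) * (1 + x)" by (simp add: algebra_simps)
  also have "\<dots> \<le> (1 - x / 2) * exp x"
    by (rule mult_left_mono) (use assms exp_ge_add_one_self[of x] in auto)
  finally show ?thesis by (simp add: exp_minus field_simps)
qed

text \<open>The end value of the eigenfunction is at most its value at \<open>xs\<close> in modulus,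
  so this positive number cancels and only the exponential weight matters. What remains is 1 <=
  exp(\<rho>) (1 - \<rho>), which is false.\<close>

lemma no_maximum_near_half_space:
  assumes setting: "subordinate_setting M Psi d S B"
    and e: "(\<Sum>i<d. (e i)\<^sup>2) = 1" and half: "\<And>y. y \<in> K \<Longrightarrow> (\<Sum>i<d. e i * (y i - xs i)) \<le> R"
    and R: "0 < R" "Psi (1 / R\<^sup>2) = 4 * l"
    and v: "0 < v" and l: "0 < l" and vl: "(v - l) / l \<le> gauss_tail / 8"
    and eigf: "eigenfunction M Psi d S B (well_potential v K) (- l) \<phi>"
    and xs: "xs \<in> vspace d" and mx: "\<And>x. x \<in> vspace d \<Longrightarrow> cmod (\<phi> x) \<le> cmod (\<phi> xs)"
  shows False
proof -
  interpret subordinated_line M Psi S "\<lambda>u \<omega>. \<Sum>i<d. e i * B u \<omega> i"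
    by (rule subordinated_line_of_setting[OF setting e])
  define T where "T = 1 / l"
  have T: "0 < T" "l * T = 1" using l by (auto simp: T_def)
  \<comment> \<open>The eighth collects three halves: the tail of \<open>S\<close>, the half of the
    time interval that is kept, and the slope in \<open>exp_minus_le_chord\<close>.\<close>
  define \<rho> where "\<rho> = gauss_tail / 8"
  have \<rho>: "0 < \<rho>" using gauss_tail_bounds by (simp add: \<rho>_def)
  define occ where "occ = occupation T R"
  have occ: "0 \<le> occ \<omega>" "occ \<omega> \<le> T" if "\<omega> \<in> space M" for \<omega>
    using occupation_bounds[OF less_imp_le[OF T(1)] that] by (auto simp: occ_def)
  have occ_meas[measurable]: "occ \<in> borel_measurable M" unfolding occ_def by (rule occupation_measurable)
  have occ_int: "integrable M occ"
    by (rule integrable_const_bound[of _ T]) (use occ in auto)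
  have EO: "gauss_tail / 2 * (T / 2) \<le> (LINT \<omega>|M. occ \<omega>)"
    unfolding occ_def
  proof (rule occupation_lower)
    fix s assume s: "s \<in> {T / 2..T}"
    hence s0: "0 \<le> s" using T by auto
    have "T / 2 * (4 * l) \<le> s * (4 * l)" by (rule mult_right_mono) (use s l in auto)
    also have "T / 2 * (4 * l) = 2 * (l * T)" by simp
    finally have "2 \<le> s * Psi (1 / R\<^sup>2)" unfolding T(2) R(2) by simp
    hence "1 / 2 \<le> prob (S s -` {R\<^sup>2..} \<inter> space M)" by (rule S_tail[OF s0 R(1)])
    hence "gauss_tail * (1 / 2) \<le> gauss_tail * prob (S s -` {R\<^sup>2..} \<inter> space M)"
      by (rule mult_left_mono) (use gauss_tail_bounds in auto)
    also have "\<dots> \<le> prob {\<omega>\<in>space M. R < time_change s \<omega>}" by (rule time_change_tail[OF s0 R(1)])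
    finally show "gauss_tail / 2 \<le> prob {\<omega>\<in>space M. R < time_change s \<omega>}" by simp
  qed (use T gauss_tail_bounds in auto)
  define p where "p = cmod (\<phi> xs)"
  have p: "0 < p"
  proof -
    obtain x where "x \<in> vspace d" "\<phi> x \<noteq> 0" using eigf by (auto simp: eigenfunction_def)
    hence "0 < cmod (\<phi> x)" "cmod (\<phi> x) \<le> p" using mx by (auto simp: p_def)
    thus ?thesis by (rule less_le_trans)
  qed
  define V where "V = well_potential v K"
  define X where "X s \<omega> = subordinate_bm d S B xs s \<omega>" for s \<omega>
  define I where "I \<omega> = - (LINT s:{0..T}|lebesgue. V (X s \<omega>))" for \<omega>
  define F where "F \<omega> = complex_of_real (exp (I \<omega>)) * \<phi> (X T \<omega>)" for \<omega>
  \<comment> \<open>A majorant of the modulus of \<open>F\<close> that is affine in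
    \<open>occ\<close> and measurable for \<open>M\<close> itself.\<close>
  define G where "G \<omega> = exp (1 + \<rho>) * (1 - l * occ \<omega> / 2) * p" for \<omega>
  have FK: "\<phi> xs = complex_of_real (exp (- l * T)) * (LINT \<omega>|completion M. F \<omega>)"
  proof -
    have "feynman_kac M d S B V (- l) \<phi>" using eigf by (simp add: eigenfunction_def V_def)
    from this[unfolded feynman_kac_def, rule_format, OF xs less_imp_le[OF T(1)]]
    show ?thesis unfolding F_def I_def X_def .
  qed
  \<comment> \<open>While the process is in \<open>K\<close>, its projected displacement is at most
    \<open>R\<close>; hence the potential acts only outside \<open>H\<close>.\<close>
  have I_le: "I \<omega> \<le> v * (T - occ \<omega>)"
    if w: "\<omega> \<in> space M" and agree: "\<And>s. 0 \<le> s \<Longrightarrow> joint_process (s, \<omega>) = (\<Sum>i<d. e i * B (S s \<omega>) \<omega> i)" for \<omega>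
  proof -
    define H where "H = {s\<in>{0..T}. R < joint_process (s, \<omega>)}"
    have H: "H \<in> sets lborel" unfolding H_def by (rule occupation_set[OF w])
    have fin: "emeasure lborel ({0..T} - H) < \<infinity>"
      using emeasure_mono[of "{0..T} - H" "{0..T}" lborel] T(1)
      by (auto simp: less_top[symmetric] top_unique)
    have int: "integrable lborel (\<lambda>s. v * indicator ({0..T} - H) s)"
      using H fin by (intro integrable_mult_right integrable_real_indicator) auto
    have meas: "(\<lambda>s. v * indicator ({0..T} - H) s) \<in> borel_measurable lborel"
      using int by (rule borel_measurable_integrable)
    have "I \<omega> = (LINT s|lebesgue. - (indicator {0..T} s *\<^sub>R V (X s \<omega>)))"
      unfolding I_def set_lebesgue_integral_def by simp
    also have "\<dots> \<le> (LINT s|lebesgue. v * indicator ({0..T} - H) s)"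
    \<comment> \<open>Only the majorant has to be integrable and non-negative: were the left
      integrand not integrable, its integral would be 0.\<close>
    proof (rule integral_mono')
      show "integrable lebesgue (\<lambda>s. v * indicator ({0..T} - H) s)"
        using int integrable_completion[OF meas] by simp
      fix s
      show "- (indicator {0..T} s *\<^sub>R V (X s \<omega>)) \<le> v * indicator ({0..T} - H) s"
      proof (cases "s \<in> {0..T} \<and> X s \<omega> \<in> K")
        case True
        have "(\<Sum>i<d. e i * B (S s \<omega>) \<omega> i) = (\<Sum>i<d. e i * (X s \<omega> i - xs i))"
          by (rule sum.cong) (auto simp: X_def subordinate_bm_def)
        also have "\<dots> \<le> R" using half True by blast
        finally have "s \<notin> H" using agree[of s] True by (auto simp: H_def)
        thus ?thesis using True v by (simp add: V_def well_potential_def)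
      next
        case False
        thus ?thesis using v by (auto simp: V_def well_potential_def indicator_def)
      qed
    qed (use v in auto)
    also have "\<dots> = (LINT s|lborel. v * indicator ({0..T} - H) s)" by (rule integral_completion[OF meas])
    also have "\<dots> = v * measure lborel ({0..T} - H)" by simp
    also have "measure lborel ({0..T} - H) = T - occ \<omega>"
    proof -
      have "measure lborel ({0..T} - H) = measure lborel {0..T} - measure lborel H"
        by (rule measure_Diff) (use H T in \<open>auto simp: H_def\<close>)
      thus ?thesis using T by (simp add: occ_def occupation_def H_def)
    qed
    finally show ?thesis .
  qed
  have FG: "AE \<omega> in M. cmod (F \<omega>) \<le> G \<omega>"
    using versions_agree AE_space
  proof eventually_elim
    case (elim \<omega>)
    \<comment> \<open>Closeness of \<open>v\<close> to \<open>l\<close> means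
      \<open>v \<le> l * (1 + \<rho>)\<close>; together with \<open>l * T = 1\<close> this isolates
      the gain \<open>- l * occ\<close>.\<close>
    have "v * (T - occ \<omega>) \<le> (l * (1 + \<rho>)) * (T - occ \<omega>)"
      by (rule mult_right_mono) (use vl l occ[OF elim(2)] in \<open>auto simp: \<rho>_def field_simps\<close>)
    also have "\<dots> = (1 + \<rho>) * (l * T) - l * occ \<omega> - \<rho> * (l * occ \<omega>)" by (simp add: algebra_simps)
    also have "\<dots> \<le> (1 + \<rho>) - l * occ \<omega>" using T \<rho> l occ[OF elim(2)] by simp
    finally have "v * (T - occ \<omega>) \<le> (1 + \<rho>) + - (l * occ \<omega>)" by simp
    moreover have "I \<omega> \<le> v * (T - occ \<omega>)" by (rule I_le[OF elim(2)]) (use elim(1) in blast)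
    ultimately have "I \<omega> \<le> (1 + \<rho>) + - (l * occ \<omega>)" by linarith
    hence "exp (I \<omega>) \<le> exp ((1 + \<rho>) + - (l * occ \<omega>))" by simp
    also have "\<dots> = exp (1 + \<rho>) * exp (- (l * occ \<omega>))" by (rule exp_add)
    also have "\<dots> \<le> exp (1 + \<rho>) * (1 - l * occ \<omega> / 2)"
      by (intro mult_left_mono exp_minus_le_chord)
         (use l occ[OF elim(2)] T in \<open>auto simp: T_def field_simps\<close>)
    finally have 1: "exp (I \<omega>) \<le> exp (1 + \<rho>) * (1 - l * occ \<omega> / 2)" .
    have 2: "cmod (\<phi> (X T \<omega>)) \<le> p"
      unfolding p_def by (rule mx) (simp add: X_def subordinate_bm_def vspace_def)
    have "cmod (F \<omega>) = exp (I \<omega>) * cmod (\<phi> (X T \<omega>))" by (simp add: F_def norm_mult)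
    also have "\<dots> \<le> G \<omega>"
      unfolding G_def by (rule mult_mono[OF 1 2]) (use order_trans[OF exp_ge_zero 1] in auto)
    finally show ?case .
  qed
  have G_int: "integrable M G" unfolding G_def using occ_int by auto
  have "p = exp (- l * T) * cmod (LINT \<omega>|completion M. F \<omega>)"
    unfolding p_def by (subst FK) (simp add: norm_mult)
  also have "\<dots> \<le> exp (- l * T) * (LINT \<omega>|completion M. cmod (F \<omega>))"
    by (intro mult_left_mono integral_norm_bound) auto
  also have "\<dots> \<le> exp (- l * T) * (LINT \<omega>|completion M. G \<omega>)"
  \<comment> \<open>Again no integrability of \<open>F\<close> is required, thanks to the default
    value 0 and the almost sure non-negativity of \<open>G\<close>.\<close>
  proof (intro mult_left_mono integral_mono_AE')
    show "integrable (completion M) G"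
      using G_int integrable_completion[OF borel_measurable_integrable[OF G_int]] by simp
    show "AE \<omega> in completion M. cmod (F \<omega>) \<le> G \<omega>" using FG by (rule AE_completion)
    have "AE \<omega> in M. 0 \<le> G \<omega>"
      using FG by eventually_elim (rule order_trans[OF norm_ge_zero])
    thus "AE \<omega> in completion M. 0 \<le> G \<omega>" by (rule AE_completion)
  qed auto
  also have "(LINT \<omega>|completion M. G \<omega>) = (LINT \<omega>|M. G \<omega>)"
    by (rule integral_completion[OF borel_measurable_integrable[OF G_int]])
  also have "\<dots> = exp (1 + \<rho>) * (1 - l * (LINT \<omega>|M. occ \<omega>) / 2) * p"
    unfolding G_def using occ_int by (simp add: prob_space)
  also have "exp (- l * T) * \<dots> = exp \<rho> * (1 - l * (LINT \<omega>|M. occ \<omega>) / 2) * p"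
  proof -
    have "exp (- l * T) * exp (1 + \<rho>) = exp \<rho>" using T by (simp add: exp_add[symmetric])
    thus ?thesis by (simp add: mult.assoc[symmetric])
  qed
  also have "\<dots> \<le> exp \<rho> * (1 - \<rho>) * p"
  proof (intro mult_right_mono mult_left_mono)
    have "\<rho> = l * (gauss_tail / 2 * (T / 2)) / 2" using T by (simp add: \<rho>_def)
    also have "\<dots> \<le> l * (LINT \<omega>|M. occ \<omega>) / 2"
      using mult_left_mono[OF EO, of l] l by simp
    finally show "1 - l * (LINT \<omega>|M. occ \<omega>) / 2 \<le> 1 - \<rho>" by simp
  qed (use p in auto)
  also have "\<dots> < exp \<rho> * exp (- \<rho>) * p"
    using p \<rho> exp_minus_greater[of \<rho>] by simp
  also have "\<dots> = p" by (simp add: exp_minus)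
  finally show False by simp
qed

theorem theorem4p5:
  fixes Psi :: "real \<Rightarrow> real"
  assumes "bernstein0 Psi"
    and "\<exists>u>0. Psi u \<noteq> 0"
    and "\<exists>mu>0. \<exists>c. 0 < c \<and> c \<le> 1 \<and> lower_scaling Psi mu c"
  shows "\<exists>\<rho>1>0. \<exists>\<rho>2>0.
    \<forall>(d::nat) (M::'w measure) S B K v eig \<phi> xs.
      d \<ge> 1 \<longrightarrow>
      subordinate_setting M Psi d S B \<longrightarrow>
      K \<subseteq> vspace d \<longrightarrow> vbounded d K \<longrightarrow> vconvex d K \<longrightarrow> vtop d interior_of K \<noteq> {} \<longrightarrow>
      v > 0 \<longrightarrow> eig < 0 \<longrightarrow>
      eigenfunction M Psi d S B (well_potential v K) eig \<phi> \<longrightarrow>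
      xs \<in> vspace d \<longrightarrow> (\<forall>x\<in>vspace d. cmod (\<phi> x) \<le> cmod (\<phi> xs)) \<longrightarrow>
      (v - \<bar>eig\<bar>) / \<bar>eig\<bar> \<le> \<rho>1 \<longrightarrow>
        xs \<in> vtop d interior_of K \<and>
        vsetdist d xs (vtop d frontier_of K)
          \<ge> 1 / sqrt (the_inv_into {0<..} Psi (\<bar>eig\<bar> / \<rho>2))"
proof (rule exI[of _ "gauss_tail / 8"], rule conjI[rotated], rule exI[of _ "1 / 4"], intro conjI allI impI)
  fix d :: nat and M :: "'w measure" and S B K v eig \<phi> xs
  assume d: "d \<ge> 1" and setting: "subordinate_setting M Psi d S B"
    and K: "K \<subseteq> vspace d" "vbounded d K" "vconvex d K" "vtop d interior_of K \<noteq> {}"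
    and v: "v > (0::real)" and eig: "eig < (0::real)"
    and eigf: "eigenfunction M Psi d S B (well_potential v K) eig \<phi>"
    and xs: "xs \<in> vspace d" and mx: "\<forall>x\<in>vspace d. cmod (\<phi> x) \<le> cmod (\<phi> xs)"
    and vl: "(v - \<bar>eig\<bar>) / \<bar>eig\<bar> \<le> gauss_tail / 8"
  \<comment> \<open>The divisor 1/4 makes \<open>Psi q\<close> four times the modulus of the
    eigenvalue. For times from T/2 on, the product with \<open>Psi q\<close> is then at least 2, as
    \<open>S_tail\<close> demands.\<close>
  define q where "q = the_inv_into {0<..} Psi (\<bar>eig\<bar> / (1 / 4))"
  have q: "0 < q" "Psi q = 4 * \<bar>eig\<bar>"
    using bernstein_inverse[OF assms, of "\<bar>eig\<bar> / (1 / 4)"] eig by (auto simp: q_def)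
  define R where "R = 1 / sqrt q"
  have R: "0 < R" "1 / R\<^sup>2 = q" using q by (auto simp: R_def power_divide)
  have "xs \<in> vtop d interior_of K \<and> vsetdist d xs (vtop d frontier_of K) \<ge> R"
  proof (rule ccontr)
    assume not: "\<not> ?thesis"
    obtain c where c: "c \<in> vtop d interior_of K" using K(4) by blast
    have cK: "c \<in> K" using c interior_of_subset[of "vtop d" K] by blast
    hence cv: "c \<in> vspace d" using K(1) by blast
    obtain \<epsilon> where \<epsilon>: "\<epsilon> > 0" "\<And>y. y \<in> vspace d \<Longrightarrow> vdist d c y < \<epsilon> \<Longrightarrow> y \<in> K"
      using c vtop_interior_iff[OF cv] by blast
    have "K \<noteq> {}" using cK by blast
    obtain z where z: "z \<in> vspace d" "z \<notin> K" "vdist d xs z < R"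
      using nearby_point_outside[OF d K(1) \<open>K \<noteq> {}\<close> K(2) xs R(1) not] by blast
    obtain e where e: "(\<Sum>i<d. (e i)\<^sup>2) = 1" "\<And>y. y \<in> K \<Longrightarrow> (\<Sum>i<d. e i * (y i - xs i)) \<le> R"
      using separating_direction[OF K(3,2) cv \<epsilon> z] by blast
    show False
      by (rule no_maximum_near_half_space[OF setting e R(1) _ v _ vl _ xs])
         (use q R eig eigf mx in auto)
  qed
  thus "xs \<in> vtop d interior_of K"
    and "vsetdist d xs (vtop d frontier_of K) \<ge> 1 / sqrt (the_inv_into {0<..} Psi (\<bar>eig\<bar> / (1 / 4)))"
    by (auto simp: R_def q_def)
qed (use gauss_tail_bounds in auto)

end
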